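(* Let $t\in(0,\frac12)$ and let $(s_j)_{j\ge1}$ be a decreasing sequence of positive numbers with $\sum_{j\ge1}s_j^{1-2t}<\infty$; put $s_0=0$. Let $\mathcal{D}\subset\mathbb{R}^2$ be the domain built from $(s_j)$ as $$\mathcal{D}=\Big(\bigcup_{k\in\mathbb{Z}}(a_k,a_k+1)\times\mathbb{R}\Big)\cup\big(\mathbb{R}\times(-2,-1)\big),$$ where $a_k=k+\sum_{j=0}^{k}s_j$ for $k\ge0$ and $a_k=k-\sum_{j=k+1}^{0}s_{-j}$ for $k\le-1$. Then for every $s\in(\frac12,1)$ one has $P_{2,s}^2(\mathcal{D})>0$.
   Context: For an open set $\Omega\subset\mathbb{R}^n$ and $s\in(0,1)$, $H^s_\Omega(\mathbb{R}^n)$ is the closure of $C_c^\infty(\Omega)$ (functions extended by zero to $\mathbb{R}^n$) with respect to the norm $$\|u\|_{H^s(\mathbb{R}^n)}=\|u\|_{L^2(\Omega)}+\left(\int_{\mathbb{R}^n}\int_{\mathbb{R}^n}\frac{(u(x)-u(y))^2}{|x-y|^{n+2s}}\,dx\,dy\right)^{1/2},$$ and (the superscript 2 is a label, not a power) $$P_{n,s}^2(\Omega)=\inf_{u\in H^s_\Omega(\mathbb{R}^n),\,u\neq0}\frac{\int_{\mathbb{R}^n}\int_{\mathbb{R}^n}\frac{(u(x)-u(y))^2}{|x-y|^{n+2s}}\,dx\,dy}{\int_\Omega u^2}.$$ *)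

theory Defs
  imports "HOL-Analysis.Analysis"
begin

text \<open>Functions on \<open>\<real>\<^sup>n\<close> (any Euclidean space \<open>'a\<close>, with \<open>n = DIM('a)\<close>) are not quotiented by
  equality almost everywhere; all notions below are invariant under it, except membership in
  \<open>test_functions\<close>.\<close>

text \<open>Differentiability of all partial derivatives of order up to \<open>k\<close> makes those of order up to
  \<open>k\<close> continuous, so no separate continuity requirement is needed for smoothness.\<close>

primrec times_diff :: "nat \<Rightarrow> ('a::euclidean_space \<Rightarrow> real) \<Rightarrow> bool" where
  "times_diff 0 f \<longleftrightarrow> True"
| "times_diff (Suc k) f \<longleftrightarrow>
     f differentiable_on UNIV \<and> (\<forall>b\<in>Basis. times_diff k (\<lambda>x. frechet_derivative f (at x) b))"

definition smooth :: "('a::euclidean_space \<Rightarrow> real) \<Rightarrow> bool" where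
  "smooth f \<longleftrightarrow> (\<forall>k. times_diff k f)"

definition test_functions :: "'a::euclidean_space set \<Rightarrow> ('a \<Rightarrow> real) set" where
  "test_functions \<Omega> =
     {f. smooth f \<and> compact (closure {x. f x \<noteq> 0}) \<and> closure {x. f x \<noteq> 0} \<subseteq> \<Omega>}"

definition L2_sq :: "'a::euclidean_space set \<Rightarrow> ('a \<Rightarrow> real) \<Rightarrow> ennreal" where
  "L2_sq \<Omega> u = (\<integral>\<^sup>+x\<in>\<Omega>. ennreal ((u x)\<^sup>2) \<partial>lebesgue)"

definition gagliardo_energy :: "real \<Rightarrow> ('a::euclidean_space \<Rightarrow> real) \<Rightarrow> ennreal" where
  "gagliardo_energy s u =
     (\<integral>\<^sup>+y. (\<integral>\<^sup>+x. ennreal ((u x - u y)\<^sup>2 / norm (x - y) powr (real DIM('a) + 2 * s)) \<partial>lebesgue) \<partial>lebesgue)"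

definition Hs_space :: "real \<Rightarrow> ('a::euclidean_space \<Rightarrow> real) set" where
  "Hs_space s = {u \<in> borel_measurable lebesgue. L2_sq UNIV u < \<infinity> \<and> gagliardo_energy s u < \<infinity>}"

text \<open>\<open>enn2real\<close> sends \<open>\<infinity>\<close> to \<open>0\<close>, so this is the intended norm only on \<open>Hs_space s\<close>.\<close>

definition Hs_norm :: "'a::euclidean_space set \<Rightarrow> real \<Rightarrow> ('a \<Rightarrow> real) \<Rightarrow> real" where
  "Hs_norm \<Omega> s u = sqrt (enn2real (L2_sq \<Omega> u)) + sqrt (enn2real (gagliardo_energy s u))"

text \<open>For \<open>0 < s < 1\<close> test functions lie in the vector space \<open>Hs_space s\<close>, so the norm of
  the difference below is never spoiled by infinite values.\<close>

definition Hs_closure :: "'a::euclidean_space set \<Rightarrow> real \<Rightarrow> ('a \<Rightarrow> real) set" where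
  "Hs_closure \<Omega> s = {u \<in> Hs_space s. \<exists>\<phi>::nat \<Rightarrow> 'a \<Rightarrow> real.
     (\<forall>m. \<phi> m \<in> test_functions \<Omega>) \<and> (\<lambda>m. Hs_norm \<Omega> s (\<lambda>x. \<phi> m x - u x)) \<longlonglongrightarrow> 0}"

text \<open>This is \<open>P\<^sup>2\<^bsub>n,s\<^esub>(\<Omega>)\<close> with \<open>n = DIM('a)\<close>.\<close>

definition fractional_poincare :: "real \<Rightarrow> 'a::euclidean_space set \<Rightarrow> ennreal" where
  "fractional_poincare s \<Omega> =
     (INF u \<in> {u \<in> Hs_closure \<Omega> s. \<not> (AE x in lebesgue. u x = 0)}. gagliardo_energy s u / L2_sq \<Omega> u)"

definition strip_left :: "(nat \<Rightarrow> real) \<Rightarrow> int \<Rightarrow> real" where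
  "strip_left \<sigma> k =
     (if k \<ge> 0 then of_int k + (\<Sum>j\<in>{0..k}. \<sigma> (nat j))
      else of_int k - (\<Sum>j\<in>{k+1..0}. \<sigma> (nat (- j))))"

definition strip_domain :: "(nat \<Rightarrow> real) \<Rightarrow> (real \<times> real) set" where
  "strip_domain \<sigma> =
     (\<Union>k. {strip_left \<sigma> k <..< strip_left \<sigma> k + 1} \<times> UNIV) \<union> UNIV \<times> {-2<..<-1}"

end

theory Submission
  imports Defs
begin

text \<open>For \<open>s > 1/2\<close> points of the line carry positive fractional capacity: a function on an interval
  of bounded length that vanishes at a single point satisfies a fractional Poincare inequality.
  So a planar domain has a positive Poincare constant as soon as, for a set of directions of positive
  measure, every line in such a direction leaves the domain within a bounded distance.

  Neither horizontal nor vertical lines have this property here, since some of them stay inside one strip.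
  Lines of slope \<open>m \<in> [1, 2]\<close> do: such a line spends a horizontal length of at most
  \<open>1\<close> in the horizontal strip, and off that strip it meets the complement of the
  disjoint open vertical strips on every interval of horizontal length \<open>1\<close>
  (\<open>slanted_line_leaves_strip_domain\<close>).

  The one-dimensional inequality is \<open>fractional_poincare_line\<close>, obtained by adding up the
  Hardy-type inequality \<open>fractional_hardy_at_zero\<close> over cells, each of which contains a zero.
  It is integrated over all lines \<open>y = c + m x\<close>, \<open>1 \<le> m \<le> 2\<close>. Since
  \<open>y' = y + m (x' - x)\<close> is a change of variables in the Gagliardo energy with Jacobian
  \<open>\<bar>x' - x\<bar>\<close>, the kernel exponent drops from \<open>2 + 2 s\<close> to
  \<open>1 + 2 s\<close>, and the energies along these lines integrate to at most a constant times the planar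
  energy (\<open>slope_energy_le_gagliardo_energy\<close>).

  This settles test functions, which are Lipschitz. The inequality passes to the closure
  (\<open>Hs_closure_poincare\<close>) because test functions have finite energy, so that a small
  \<open>Hs_norm\<close> really means that energy and mass of the difference are small. Finally the quotient
  \<open>0 / 0 = 0\<close> cannot occur: a square integrable function without energy vanishes almost
  everywhere.\<close>

section \<open>Fractional Hardy and Poincare inequalities on the line\<close>

definition line_energy :: "real \<Rightarrow> (real \<Rightarrow> real) \<Rightarrow> real \<Rightarrow> ennreal" where
  "line_energy s f x = (\<integral>\<^sup>+y. ennreal ((f x - f y)\<^sup>2 / \<bar>x - y\<bar> powr (1 + 2 * s)) \<partial>lborel)"

lemma line_energy_measurable [measurable]:
  assumes [measurable]: "f \<in> borel_measurable borel"
  shows "line_energy s f \<in> borel_measurable borel"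
proof -
  have "(\<lambda>x. line_energy s f x) \<in> borel_measurable lborel"
    unfolding line_energy_def by measurable
  then show ?thesis by simp
qed

lemma nn_integral_powr_tail:
  fixes a s :: real
  assumes "0 < a" and "0 < s"
  shows "(\<integral>\<^sup>+r. ennreal (r powr (-(1 + 2 * s))) * indicator {a..} r \<partial>lborel)
       = ennreal (a powr (-(2 * s)) / (2 * s))"
  using nn_integral_has_integral_lebesgue'[OF _ has_integral_powr_to_inf[of "-(1 + 2 * s)" a]] assms
  by simp

lemma square_sum_le_weighted:
  fixes a d t :: real
  assumes "0 < t"
  shows "(a + d)\<^sup>2 \<le> (1 + t) * a\<^sup>2 + (1 + 1 / t) * d\<^sup>2"
proof -
  have "0 \<le> (t * a - d)\<^sup>2 / t" using assms by simp
  also have "\<dots> = (1 + t) * a\<^sup>2 + (1 + 1 / t) * d\<^sup>2 - (a + d)\<^sup>2"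
    using assms by (simp add: field_simps power2_eq_square)
  finally show ?thesis by simp
qed

text \<open>The factors are the cost of removing the weight \<open>r powr (-2 s)\<close> on \<open>(0, L)\<close> and the
  coefficient of the difference in the weighted square inequality; the divisor is the margin left after
  absorption.\<close>

definition hardy_const :: "real \<Rightarrow> real \<Rightarrow> real" where
  "hardy_const s L = L powr (2 * s) * (2 * s / (2 * s - 1) / (1 / 2 - 2 powr (-(2 * s))))"

lemma two_powr_neg_lt_half: "1/2 < s \<Longrightarrow> 2 powr (-(2 * s)) < (1/2 :: real)"
proof -
  assume "1/2 < s"
  then have "2 powr (-(2 * s)) < (2::real) powr (-1)" by (intro powr_less_mono) auto
  also have "(2::real) powr (-1) = 1/2" by (simp add: powr_minus)
  finally show ?thesis .
qed

text \<open>The weight \<open>r powr (-2 s)\<close> makes the estimate scale invariant, which allows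
  \<open>g r\<close> to be compared with the values \<open>g \<rho>\<close> for \<open>\<rho> < r/2\<close> instead of
  with \<open>g 0 = 0\<close>. Averaging over \<open>\<rho>\<close> reproduces the weighted integral on the right with the
  factor \<open>2 powr (-2 s)\<close> against \<open>1/2\<close> on the left; the former is smaller exactly when
  \<open>s > 1/2\<close>, so the term can be absorbed. The linear bound on \<open>g\<close> makes it finite, without which
  absorption is impossible.\<close>

lemma fractional_hardy_at_zero:
  fixes g :: "real \<Rightarrow> real" and s R L K :: real
  assumes g [measurable]: "g \<in> borel_measurable borel"
    and s: "1/2 < s" "s < 1"
    and R: "R \<le> L"
    and lip: "\<And>r. 0 < r \<Longrightarrow> r < R \<Longrightarrow> \<bar>g r\<bar> \<le> K * r"
  shows "(\<integral>\<^sup>+r. indicator {0<..<R} r * ennreal ((g r)\<^sup>2) \<partial>lborel)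
       \<le> ennreal (hardy_const s L) * (\<integral>\<^sup>+r. indicator {0<..<R} r *
            line_energy s g r \<partial>lborel)"
proof (cases "R > 0")
  case False
  then have "{0<..<R} = {}" by auto
  then show ?thesis by simp
next
  case True
  define A where "A = (\<integral>\<^sup>+r. indicator {0<..<R} r * ennreal ((g r)\<^sup>2 * r powr (-(2 * s))) \<partial>lborel)"
  define J where "J = line_energy s g"
  define E where "E = (\<integral>\<^sup>+r. indicator {0<..<R} r * J r \<partial>lborel)"
  define b where "b = 2 * s / (2 * s - 1)"
  define h where "h = (1/2 :: real)"
  define q where "q = (2::real) powr (-(2 * s))"
  have J [measurable]: "J \<in> borel_measurable lborel" by (simp add: J_def)
  have b: "b > 0" using s by (simp add: b_def)
  have q: "0 < q" "q < h" using two_powr_neg_lt_half[OF s(1)] by (auto simp: q_def h_def)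
  have "A \<le> (\<integral>\<^sup>+r. ennreal (K\<^sup>2 * R powr (2 - 2 * s)) * indicator {0<..<R} r \<partial>lborel)"
    unfolding A_def
  proof (rule nn_integral_mono)
    fix r
    show "indicator {0<..<R} r * ennreal ((g r)\<^sup>2 * r powr (-(2 * s)))
       \<le> ennreal (K\<^sup>2 * R powr (2 - 2 * s)) * indicator {0<..<R} r"
    proof (cases "r \<in> {0<..<R}")
      case r: True
      then have "(g r)\<^sup>2 \<le> (K * r)\<^sup>2"
        using lip[of r] abs_le_square_iff[of "g r" "K * r"] by auto
      then have "(g r)\<^sup>2 * r powr (-(2 * s)) \<le> K\<^sup>2 * (r\<^sup>2 * r powr (-(2 * s)))"
        by (metis mult.assoc mult_right_mono powr_ge_zero power_mult_distrib)
      also have "r\<^sup>2 * r powr (-(2 * s)) = r powr (2 - 2 * s)"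
        using r by (simp add: powr_diff powr_minus field_simps)
      also have "K\<^sup>2 * r powr (2 - 2 * s) \<le> K\<^sup>2 * R powr (2 - 2 * s)"
        using r s by (intro mult_left_mono powr_mono2) auto
      finally show ?thesis using r by (simp add: ennreal_leI)
    qed auto
  qed
  also have "\<dots> < \<infinity>"
    using True by (simp add: nn_integral_cmult_indicator ennreal_mult_less_top)
  finally have A_fin: "A < \<infinity>" .
  \<comment> \<open>The inequality for fixed \<open>r\<close>, averaged over \<open>0 < \<rho> \<le> r/2\<close>; there \<open>\<bar>r - \<rho>\<bar> \<le> r\<close>, so the weight is dominated by the kernel.\<close>
  have pointwise: "ennreal h * ennreal ((g r)\<^sup>2 * r powr (-(2 * s)))
      \<le> ennreal (2 * s) * (\<integral>\<^sup>+\<rho>. indicator {0<..r/2} \<rho> * ennreal ((g \<rho>)\<^sup>2 * r powr (-(1 + 2 * s))) \<partial>lborel)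
        + ennreal b * J r" if r: "0 < r" for r
  proof -
    have "ennreal h * ennreal ((g r)\<^sup>2 * r powr (-(2 * s)))
        = ennreal ((g r)\<^sup>2 * r powr (-(1 + 2 * s)) * (r / 2))"
      using r by (simp add: h_def ennreal_mult'[symmetric] powr_diff powr_minus field_simps powr_add
          del: ennreal_half ennreal_divide_numeral)
    also have "\<dots> = (\<integral>\<^sup>+\<rho>. ennreal ((g r)\<^sup>2 * r powr (-(1 + 2 * s))) * indicator {0<..r/2} \<rho> \<partial>lborel)"
      using r by (subst nn_integral_cmult_indicator) (auto simp: ennreal_mult'[symmetric] mult.assoc)
    also have "\<dots> \<le> (\<integral>\<^sup>+\<rho>. ennreal (2 * s) * (indicator {0<..r/2} \<rho> * ennreal ((g \<rho>)\<^sup>2 * r powr (-(1 + 2 * s))))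
        + ennreal b * ennreal ((g r - g \<rho>)\<^sup>2 / \<bar>r - \<rho>\<bar> powr (1 + 2 * s)) \<partial>lborel)"
    proof (rule nn_integral_mono)
      fix \<rho>
      show "ennreal ((g r)\<^sup>2 * r powr (-(1 + 2 * s))) * indicator {0<..r/2} \<rho>
         \<le> ennreal (2 * s) * (indicator {0<..r/2} \<rho> * ennreal ((g \<rho>)\<^sup>2 * r powr (-(1 + 2 * s))))
           + ennreal b * ennreal ((g r - g \<rho>)\<^sup>2 / \<bar>r - \<rho>\<bar> powr (1 + 2 * s))"
      proof (cases "\<rho> \<in> {0<..r/2}")
        case rho: True
        \<comment> \<open>The choice \<open>2 s\<close> of the coefficient cancels the \<open>2 s\<close> from the tail integral of \<open>r powr (-(1 + 2 s))\<close>.\<close>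
        have "(g r)\<^sup>2 \<le> 2 * s * (g \<rho>)\<^sup>2 + b * (g r - g \<rho>)\<^sup>2"
          using square_sum_le_weighted[of "2 * s - 1" "g \<rho>" "g r - g \<rho>"] s
          by (simp add: b_def field_simps)
        then have "(g r)\<^sup>2 * r powr (-(1 + 2 * s))
            \<le> (2 * s * (g \<rho>)\<^sup>2 + b * (g r - g \<rho>)\<^sup>2) * r powr (-(1 + 2 * s))"
          by (intro mult_right_mono) auto
        also have "\<dots> = 2 * s * ((g \<rho>)\<^sup>2 * r powr (-(1 + 2 * s))) + b * ((g r - g \<rho>)\<^sup>2 / r powr (1 + 2 * s))"
          unfolding powr_minus_divide by (simp add: add_divide_distrib algebra_simps)
        also have "\<dots> \<le> 2 * s * ((g \<rho>)\<^sup>2 * r powr (-(1 + 2 * s))) + b * ((g r - g \<rho>)\<^sup>2 / \<bar>r - \<rho>\<bar> powr (1 + 2 * s))"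
          using rho b s by (intro add_left_mono mult_left_mono divide_left_mono powr_mono2) auto
        finally have *: "(g r)\<^sup>2 * r powr (-(1 + 2 * s)) \<le> \<dots>" .
        have "ennreal ((g r)\<^sup>2 * r powr (-(1 + 2 * s)))
           \<le> ennreal (2 * s * ((g \<rho>)\<^sup>2 * r powr (-(1 + 2 * s))) + b * ((g r - g \<rho>)\<^sup>2 / \<bar>r - \<rho>\<bar> powr (1 + 2 * s)))"
          using * by (rule ennreal_leI)
        also have "\<dots> = ennreal (2 * s) * ennreal ((g \<rho>)\<^sup>2 * r powr (-(1 + 2 * s)))
           + ennreal b * ennreal ((g r - g \<rho>)\<^sup>2 / \<bar>r - \<rho>\<bar> powr (1 + 2 * s))"
          using s b by (simp add: ennreal_mult[symmetric])
        finally show ?thesis using rho by simp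
      qed auto
    qed
    also have "\<dots> = ennreal (2 * s) * (\<integral>\<^sup>+\<rho>. indicator {0<..r/2} \<rho> * ennreal ((g \<rho>)\<^sup>2 * r powr (-(1 + 2 * s))) \<partial>lborel)
        + ennreal b * J r"
      unfolding J_def line_energy_def by (subst nn_integral_add) (auto simp: nn_integral_cmult)
    finally show ?thesis .
  qed
  define W :: "real \<Rightarrow> real \<Rightarrow> ennreal" where
    "W r \<rho> = (if 0 < r \<and> r < R \<and> 0 < \<rho> \<and> \<rho> \<le> r / 2 then ennreal ((g \<rho>)\<^sup>2 * r powr (-(1 + 2 * s))) else 0)" for r \<rho>
  have W [measurable]: "case_prod W \<in> borel_measurable (lborel \<Otimes>\<^sub>M lborel)"
    unfolding W_def by measurable
  have W_eq: "W r \<rho> = indicator {0<..r/2} \<rho> * ennreal ((g \<rho>)\<^sup>2 * r powr (-(1 + 2 * s)))"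
    if "r \<in> {0<..<R}" for r \<rho> using that by (simp add: W_def indicator_def)
  have "ennreal h * A = (\<integral>\<^sup>+r. indicator {0<..<R} r * (ennreal h * ennreal ((g r)\<^sup>2 * r powr (-(2 * s)))) \<partial>lborel)"
    unfolding A_def by (subst nn_integral_cmult[symmetric]) (auto simp: mult_ac)
  also have "\<dots> \<le> (\<integral>\<^sup>+r. ennreal (2 * s) * (\<integral>\<^sup>+\<rho>. W r \<rho> \<partial>lborel)
        + ennreal b * (indicator {0<..<R} r * J r) \<partial>lborel)"
  proof (rule nn_integral_mono)
    fix r
    show "indicator {0<..<R} r * (ennreal h * ennreal ((g r)\<^sup>2 * r powr (-(2 * s))))
        \<le> ennreal (2 * s) * (\<integral>\<^sup>+\<rho>. W r \<rho> \<partial>lborel)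
          + ennreal b * (indicator {0<..<R} r * J r)"
      using pointwise[of r] by (cases "r \<in> {0<..<R}") (auto simp: W_eq)
  qed
  also have "\<dots> = ennreal (2 * s) * (\<integral>\<^sup>+r. \<integral>\<^sup>+\<rho>. W r \<rho> \<partial>lborel \<partial>lborel)
        + ennreal b * E"
    unfolding E_def by (subst nn_integral_add) (auto simp: nn_integral_cmult)
  also have "(\<integral>\<^sup>+r. \<integral>\<^sup>+\<rho>. W r \<rho> \<partial>lborel \<partial>lborel)
      = (\<integral>\<^sup>+\<rho>. \<integral>\<^sup>+r. W r \<rho> \<partial>lborel \<partial>lborel)"
    by (rule lborel_pair.Fubini') measurable
  also have "\<dots> \<le> (\<integral>\<^sup>+\<rho>. ennreal (q / (2 * s)) * (indicator {0<..<R} \<rho> * ennreal ((g \<rho>)\<^sup>2 * \<rho> powr (-(2 * s)))) \<partial>lborel)"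
  proof (rule nn_integral_mono)
    fix \<rho> :: real
    show "(\<integral>\<^sup>+r. W r \<rho> \<partial>lborel)
       \<le> ennreal (q / (2 * s)) * (indicator {0<..<R} \<rho> * ennreal ((g \<rho>)\<^sup>2 * \<rho> powr (-(2 * s))))"
    proof (cases "\<rho> \<in> {0<..<R}")
      case rho: True
      have "(\<integral>\<^sup>+r. W r \<rho> \<partial>lborel)
          \<le> (\<integral>\<^sup>+r. ennreal ((g \<rho>)\<^sup>2) * (ennreal (r powr (-(1 + 2 * s))) * indicator {2 * \<rho>..} r) \<partial>lborel)"
        by (intro nn_integral_mono) (auto simp: W_def indicator_def ennreal_mult)
      also have "\<dots> = ennreal ((g \<rho>)\<^sup>2) * ennreal ((2 * \<rho>) powr (-(2 * s)) / (2 * s))"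
        using rho s nn_integral_powr_tail[of "2 * \<rho>" s] by (subst nn_integral_cmult) auto
      also have "\<dots> = ennreal (q / (2 * s)) * ennreal ((g \<rho>)\<^sup>2 * \<rho> powr (-(2 * s)))"
        using rho s q by (simp add: ennreal_mult[symmetric] q_def powr_mult mult_ac)
      finally show ?thesis using rho by simp
    next
      case False
      then have "(\<lambda>r. W r \<rho>) = (\<lambda>r. 0)"
        by (auto simp: W_def fun_eq_iff)
      then show ?thesis by simp
    qed
  qed
  also have "\<dots> = ennreal (q / (2 * s)) * A"
    unfolding A_def by (subst nn_integral_cmult) auto
  finally have "ennreal h * A \<le> ennreal (2 * s) * (ennreal (q / (2 * s)) * A) + ennreal b * E"
    by (simp add: mult_left_mono add_right_mono)
  also have "ennreal (2 * s) * (ennreal (q / (2 * s)) * A) = ennreal q * A"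
    using s q by (simp add: mult.assoc[symmetric] ennreal_mult[symmetric])
  finally have absorb: "ennreal h * A \<le> ennreal q * A + ennreal b * E" .
  have A_le: "A \<le> ennreal (b / (h - q)) * E"
  proof (cases "E = \<infinity>")
    case True
    then show ?thesis using q b by (simp add: ennreal_mult_top)
  next
    case False
    then obtain e where e: "E = ennreal e" "0 \<le> e" by (cases E) auto
    obtain a where a: "A = ennreal a" "0 \<le> a" using A_fin by (cases A) auto
    have "h * a \<le> q * a + b * e"
      using absorb a e q b by (simp add: h_def[symmetric] ennreal_mult[symmetric] ennreal_plus[symmetric] del: ennreal_plus)
    then have "a \<le> b / (h - q) * e" using q by (simp add: field_simps)
    then show ?thesis using a e q b by (simp add: ennreal_mult[symmetric] ennreal_leI)
  qed
  have "(\<integral>\<^sup>+r. indicator {0<..<R} r * ennreal ((g r)\<^sup>2) \<partial>lborel)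
      \<le> (\<integral>\<^sup>+r. ennreal (L powr (2 * s)) * (indicator {0<..<R} r * ennreal ((g r)\<^sup>2 * r powr (-(2 * s)))) \<partial>lborel)"
  proof (rule nn_integral_mono)
    fix r
    show "indicator {0<..<R} r * ennreal ((g r)\<^sup>2)
       \<le> ennreal (L powr (2 * s)) * (indicator {0<..<R} r * ennreal ((g r)\<^sup>2 * r powr (-(2 * s))))"
    proof (cases "r \<in> {0<..<R}")
      case r: True
      have "(g r)\<^sup>2 = r powr (2 * s) * ((g r)\<^sup>2 * r powr (-(2 * s)))"
        using r by (simp add: powr_minus)
      also have "\<dots> \<le> L powr (2 * s) * ((g r)\<^sup>2 * r powr (-(2 * s)))"
        using r R s by (intro mult_right_mono powr_mono2) auto
      finally show ?thesis using r by (simp add: ennreal_mult[symmetric] ennreal_leI)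
    qed auto
  qed
  also have "\<dots> = ennreal (L powr (2 * s)) * A"
    unfolding A_def by (subst nn_integral_cmult) auto
  also have "\<dots> \<le> ennreal (L powr (2 * s)) * (ennreal (b / (h - q)) * E)"
    by (intro mult_left_mono A_le) auto
  also have "\<dots> = ennreal (hardy_const s L) * E"
  proof -
    have "hardy_const s L = L powr (2 * s) * (b / (h - q))"
      by (simp add: hardy_const_def b_def q_def h_def)
    then show ?thesis using q b by (simp add: mult.assoc[symmetric] ennreal_mult[symmetric])
  qed
  finally show ?thesis unfolding E_def J_def .
qed

text \<open>Translations and reflections let the Hardy inequality be used on both sides of an arbitrary zero.\<close>

lemma line_energy_isometry:
  assumes [measurable]: "f \<in> borel_measurable borel" and c: "\<bar>c\<bar> = 1"
  shows "line_energy s (\<lambda>r. f (p + c * r)) r = line_energy s f (p + c * r)"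
proof -
  have "\<bar>r - \<rho>\<bar> = \<bar>p + c * r - (p + c * \<rho>)\<bar>" for \<rho>
    using c by (metis abs_mult add_diff_cancel_left mult_1 right_diff_distrib)
  then show ?thesis
    unfolding line_energy_def
    using nn_integral_real_affine[of "\<lambda>y. ennreal ((f (p + c * r) - f y)\<^sup>2 / \<bar>p + c * r - y\<bar> powr (1 + 2 * s))" c p] c
    by auto
qed

lemma fractional_hardy_one_sided:
  assumes f [measurable]: "f \<in> borel_measurable borel"
    and s: "1/2 < s" "s < 1" and c: "\<bar>c\<bar> = 1" and R: "R \<le> L"
    and lip: "\<And>x y. \<bar>f x - f y\<bar> \<le> K * \<bar>x - y\<bar>" and p: "f p = 0"
  shows "(\<integral>\<^sup>+x. indicator {0<..<R} (c * (x - p)) * ennreal ((f x)\<^sup>2) \<partial>lborel)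
       \<le> ennreal (hardy_const s L) * (\<integral>\<^sup>+x. indicator {0<..<R} (c * (x - p)) * line_energy s f x \<partial>lborel)"
proof -
  have cc: "c * (c * r) = r" for r
    using c by (simp add: mult.assoc[symmetric] abs_if split: if_splits)
  have affine: "(\<integral>\<^sup>+x. indicator {0<..<R} (c * (x - p)) * F x \<partial>lborel)
      = (\<integral>\<^sup>+r. indicator {0<..<R} r * F (p + c * r) \<partial>lborel)"
    if [measurable]: "F \<in> borel_measurable borel" for F :: "real \<Rightarrow> ennreal"
    using nn_integral_real_affine[of "\<lambda>x. indicator {0<..<R} (c * (x - p)) * F x" c p] c cc
    by auto
  have "(\<integral>\<^sup>+r. indicator {0<..<R} r * ennreal ((f (p + c * r))\<^sup>2) \<partial>lborel)
      \<le> ennreal (hardy_const s L) * (\<integral>\<^sup>+r. indicator {0<..<R} r * line_energy s (\<lambda>r. f (p + c * r)) r \<partial>lborel)"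
  proof (rule fractional_hardy_at_zero[OF _ s R, where K = K])
    fix r :: real assume "0 < r"
    then show "\<bar>f (p + c * r)\<bar> \<le> K * r"
      using lip[of "p + c * r" p] p c by (simp add: abs_mult)
  qed auto
  then show ?thesis by (simp add: affine line_energy_isometry c)
qed

text \<open>Working on both sides of the zero keeps all outer integration inside the cell, so cells can be summed
  up without overlap.\<close>

lemma fractional_poincare_cell:
  assumes f [measurable]: "f \<in> borel_measurable borel"
    and s: "1/2 < s" "s < 1" and ab: "b - a \<le> L"
    and lip: "\<And>x y. \<bar>f x - f y\<bar> \<le> K * \<bar>x - y\<bar>" and p: "p \<in> {a..b}" "f p = 0"
  shows "(\<integral>\<^sup>+x. indicator {a..<b} x * ennreal ((f x)\<^sup>2) \<partial>lborel)
       \<le> ennreal (hardy_const s L) * (\<integral>\<^sup>+x. indicator {a..<b} x * line_energy s f x \<partial>lborel)"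
proof -
  have R: "b - p \<le> L" "p - a \<le> L" using p ab by auto
  let ?r = "\<lambda>x. indicator {0<..<b - p} (1 * (x - p)) :: ennreal"
  let ?l = "\<lambda>x. indicator {0<..<p - a} (-1 * (x - p)) :: ennreal"
  have "(\<integral>\<^sup>+x. indicator {a..<b} x * ennreal ((f x)\<^sup>2) \<partial>lborel)
      \<le> (\<integral>\<^sup>+x. ?r x * ennreal ((f x)\<^sup>2) + ?l x * ennreal ((f x)\<^sup>2) \<partial>lborel)"
  proof (rule nn_integral_mono_AE)
    show "AE x in lborel. indicator {a..<b} x * ennreal ((f x)\<^sup>2)
        \<le> ?r x * ennreal ((f x)\<^sup>2) + ?l x * ennreal ((f x)\<^sup>2)"
      using AE_lborel_singleton[of a] AE_lborel_singleton[of p]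
      by eventually_elim (auto simp: indicator_def)
  qed
  also have "\<dots> = (\<integral>\<^sup>+x. ?r x * ennreal ((f x)\<^sup>2) \<partial>lborel) + (\<integral>\<^sup>+x. ?l x * ennreal ((f x)\<^sup>2) \<partial>lborel)"
    by (rule nn_integral_add) measurable
  also have "\<dots> \<le> ennreal (hardy_const s L) * (\<integral>\<^sup>+x. ?r x * line_energy s f x \<partial>lborel)
      + ennreal (hardy_const s L) * (\<integral>\<^sup>+x. ?l x * line_energy s f x \<partial>lborel)"
    by (intro add_mono fractional_hardy_one_sided[OF f s _ _ lip p(2)] R) auto
  also have "\<dots> = ennreal (hardy_const s L) * (\<integral>\<^sup>+x. ?r x * line_energy s f x + ?l x * line_energy s f x \<partial>lborel)"
    by (subst nn_integral_add) (auto simp: distrib_left)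
  also have "\<dots> \<le> ennreal (hardy_const s L) * (\<integral>\<^sup>+x. indicator {a..<b} x * line_energy s f x \<partial>lborel)"
    using p by (intro mult_left_mono nn_integral_mono) (auto simp: indicator_def)
  finally show ?thesis .
qed

lemma nn_integral_cells:
  fixes F :: "real \<Rightarrow> ennreal" and L :: real
  assumes [measurable]: "F \<in> borel_measurable borel" and L: "0 < L"
  shows "(\<integral>\<^sup>+x. F x \<partial>lborel)
       = (\<Sum>n. \<integral>\<^sup>+x. indicator {L * of_int (int_decode n)..<L * (of_int (int_decode n) + 1)} x * F x \<partial>lborel)"
proof -
  define I where "I n = {L * of_int (int_decode n)..<L * (of_int (int_decode n) + 1)}" for n
  have I_iff: "x \<in> I n \<longleftrightarrow> \<lfloor>x / L\<rfloor> = int_decode n" for x n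
    using L by (auto simp: I_def floor_eq_iff field_simps)
  have dis: "disjoint_family I"
    by (auto simp: disjoint_family_on_def I_iff dest: injD[OF inj_int_decode])
  have un: "(\<Union>n. I n) = UNIV"
    using I_iff by (metis UNIV_eq_I UN_iff UNIV_I surj_int_decode surjD)
  have "(\<integral>\<^sup>+x. F x \<partial>lborel) = (\<integral>\<^sup>+x. (\<Sum>n. indicator (I n) x * F x) \<partial>lborel)"
    using suminf_indicator[OF dis] un by (simp add: ennreal_suminf_multc)
  also have "\<dots> = (\<Sum>n. \<integral>\<^sup>+x. indicator (I n) x * F x \<partial>lborel)"
    by (rule nn_integral_suminf) (auto simp: I_def)
  finally show ?thesis by (simp add: I_def)
qed

lemma fractional_poincare_line:
  assumes f [measurable]: "f \<in> borel_measurable borel"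
    and s: "1/2 < s" "s < 1" and L: "0 < L"
    and lip: "\<And>x y. \<bar>f x - f y\<bar> \<le> K * \<bar>x - y\<bar>"
    and zeros: "\<And>a. \<exists>p\<in>{a..a + L}. f p = 0"
  shows "(\<integral>\<^sup>+x. ennreal ((f x)\<^sup>2) \<partial>lborel)
       \<le> ennreal (hardy_const s L) * (\<integral>\<^sup>+x. line_energy s f x \<partial>lborel)"
proof -
  have "(\<integral>\<^sup>+x. ennreal ((f x)\<^sup>2) \<partial>lborel)
      = (\<Sum>n. \<integral>\<^sup>+x. indicator {L * of_int (int_decode n)..<L * (of_int (int_decode n) + 1)} x * ennreal ((f x)\<^sup>2) \<partial>lborel)"
    by (rule nn_integral_cells[OF _ L]) measurable
  also have "\<dots> \<le> (\<Sum>n. ennreal (hardy_const s L) *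
      (\<integral>\<^sup>+x. indicator {L * of_int (int_decode n)..<L * (of_int (int_decode n) + 1)} x * line_energy s f x \<partial>lborel))"
  proof (intro suminf_le)
    fix n
    obtain p where "p \<in> {L * of_int (int_decode n)..L * (of_int (int_decode n) + 1)}" "f p = 0"
      using zeros[of "L * of_int (int_decode n)"] by (auto simp: distrib_left)
    then show "(\<integral>\<^sup>+x. indicator {L * of_int (int_decode n)..<L * (of_int (int_decode n) + 1)} x * ennreal ((f x)\<^sup>2) \<partial>lborel)
       \<le> ennreal (hardy_const s L) *
      (\<integral>\<^sup>+x. indicator {L * of_int (int_decode n)..<L * (of_int (int_decode n) + 1)} x * line_energy s f x \<partial>lborel)"
      by (intro fractional_poincare_cell[OF f s _ lip]) (auto simp: distrib_left)
  qed auto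
  also have "\<dots> = ennreal (hardy_const s L) * (\<integral>\<^sup>+x. line_energy s f x \<partial>lborel)"
    by (subst nn_integral_cells[OF _ L, of "line_energy s f"]) auto
  finally show ?thesis .
qed

section \<open>Slicing the Gagliardo energy along slanted lines\<close>

lemma borel_measurable_prod_real [measurable_dest]:
  fixes u :: "real \<times> real \<Rightarrow> 'b::topological_space"
  assumes "u \<in> borel_measurable borel"
  shows "u \<in> borel_measurable (borel \<Otimes>\<^sub>M borel)"
  using assms by (simp add: borel_prod)

lemma nn_integral_lborel_plane:
  fixes F :: "real \<times> real \<Rightarrow> ennreal"
  assumes "F \<in> borel_measurable borel"
  shows "(\<integral>\<^sup>+z. F z \<partial>lborel) = (\<integral>\<^sup>+x. \<integral>\<^sup>+y. F (x, y) \<partial>lborel \<partial>lborel)"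
proof -
  have "F \<in> borel_measurable (lborel \<Otimes>\<^sub>M lborel)" using assms by (simp add: lborel_prod)
  then show ?thesis by (simp add: lborel.nn_integral_fst lborel_prod)
qed

lemma gagliardo_energy_lborel:
  "gagliardo_energy s u =
     (\<integral>\<^sup>+z. \<integral>\<^sup>+w. ennreal ((u z - u w)\<^sup>2 / norm (z - w) powr (real DIM('a) + 2 * s)) \<partial>lborel \<partial>lborel)"
  for u :: "'a::euclidean_space \<Rightarrow> real"
  unfolding gagliardo_energy_def nn_integral_completion
  by (simp add: power2_commute norm_minus_commute)

lemma gagliardo_energy_plane:
  fixes u :: "real \<times> real \<Rightarrow> real"
  assumes u: "u \<in> borel_measurable borel"
  shows "gagliardo_energy s u = (\<integral>\<^sup>+x. \<integral>\<^sup>+y. \<integral>\<^sup>+x'. \<integral>\<^sup>+y'.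
     ennreal ((u (x, y) - u (x', y'))\<^sup>2 / norm (x - x', y - y') powr (2 + 2 * s)) \<partial>lborel \<partial>lborel \<partial>lborel \<partial>lborel)"
proof -
  note [measurable] = u
  have "(\<integral>\<^sup>+w. ennreal ((u z - u w)\<^sup>2 / norm (z - w) powr (2 + 2 * s)) \<partial>lborel) =
      (\<integral>\<^sup>+x'. \<integral>\<^sup>+y'. ennreal ((u z - u (x', y'))\<^sup>2 / norm (z - (x', y')) powr (2 + 2 * s)) \<partial>lborel \<partial>lborel)" for z
    by (rule nn_integral_lborel_plane) measurable
  moreover have "(\<lambda>z. \<integral>\<^sup>+w. ennreal ((u z - u w)\<^sup>2 / norm (z - w) powr (2 + 2 * s)) \<partial>lborel) \<in> borel_measurable lborel"
    by measurable
  ultimately show ?thesis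
    unfolding gagliardo_energy_lborel
    by (simp add: nn_integral_lborel_plane)
qed

text \<open>On a segment of slope \<open>m \<le> 2\<close> the planar distance is at most \<open>sqrt 5\<close> times the
  horizontal one; the factor \<open>\<bar>d\<bar>\<close> is the Jacobian of \<open>m \<mapsto> m d\<close>.\<close>

lemma sheared_kernel_bound:
  fixes a d m s :: real
  assumes m: "1 \<le> m" "m \<le> 2" and d: "d \<noteq> 0" and s: "0 < s" and a: "0 \<le> a"
  shows "a / \<bar>d\<bar> powr (1 + 2 * s) \<le> 5 powr (1 + s) * (\<bar>d\<bar> * (a / norm (d, m * d) powr (2 + 2 * s)))"
proof -
  have n: "norm (d, m * d) = sqrt (1 + m\<^sup>2) * \<bar>d\<bar>"
  proof -
    have "(norm d)\<^sup>2 + (norm (m * d))\<^sup>2 = (1 + m\<^sup>2) * d\<^sup>2"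
      by (simp add: power_mult_distrib distrib_right)
    then show ?thesis by (simp add: norm_Pair real_sqrt_mult)
  qed
  have m5: "1 + m\<^sup>2 \<le> 5" using m power_mono[of m 2 2] by simp
  have "norm (d, m * d) powr (2 + 2 * s) = sqrt (1 + m\<^sup>2) powr (2 + 2 * s) * \<bar>d\<bar> powr (2 + 2 * s)"
    unfolding n by (simp add: powr_mult)
  also have "sqrt (1 + m\<^sup>2) powr (2 + 2 * s) = (1 + m\<^sup>2) powr (1 + s)"
    by (simp add: powr_half_sqrt[symmetric] powr_powr add_pos_nonneg algebra_simps)
  also have "\<dots> * \<bar>d\<bar> powr (2 + 2 * s) \<le> 5 powr (1 + s) * \<bar>d\<bar> powr (2 + 2 * s)"
    using m5 s by (intro mult_right_mono powr_mono2) (auto simp: add_nonneg_nonneg)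
  also have "\<bar>d\<bar> powr (2 + 2 * s) = \<bar>d\<bar> * \<bar>d\<bar> powr (1 + 2 * s)"
    using d by (simp add: powr_mult_base)
  finally have le: "norm (d, m * d) powr (2 + 2 * s) \<le> 5 powr (1 + s) * (\<bar>d\<bar> * \<bar>d\<bar> powr (1 + 2 * s))" .
  have pos: "0 < norm (d, m * d) powr (2 + 2 * s)" using d by (simp add: prod_eq_iff zero_prod_def)
  have "a * norm (d, m * d) powr (2 + 2 * s) \<le> a * (5 powr (1 + s) * (\<bar>d\<bar> * \<bar>d\<bar> powr (1 + 2 * s)))"
    using le a by (intro mult_left_mono) auto
  then show ?thesis using pos d by (simp add: field_simps)
qed

text \<open>In the inner integral of the Gagliardo energy the second coordinate \<open>y'\<close> is replaced by the slope
  \<open>m = (y' - y) / (x' - x)\<close>, and for fixed \<open>m\<close> the first point \<open>(x, y)\<close> is described by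
  \<open>x\<close> and the intercept \<open>c = y - m x\<close>.\<close>

lemma slope_energy_le_gagliardo_energy:
  fixes u :: "real \<times> real \<Rightarrow> real" and s :: real
  assumes u: "u \<in> borel_measurable borel" and s: "0 < s"
  shows "(\<integral>\<^sup>+m. indicator {1..2} m * (\<integral>\<^sup>+c. \<integral>\<^sup>+x. line_energy s (\<lambda>x. u (x, c + m * x)) x \<partial>lborel \<partial>lborel) \<partial>lborel)
       \<le> ennreal (5 powr (1 + s)) * gagliardo_energy s u"
proof -
  note [measurable] = u
  define T :: "real \<Rightarrow> real \<Rightarrow> real \<Rightarrow> real \<Rightarrow> ennreal" where
    "T m x y x' = ennreal ((u (x, y) - u (x', y + m * (x' - x)))\<^sup>2 / \<bar>x - x'\<bar> powr (1 + 2 * s))" for m x y x'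
  have slope: "(\<integral>\<^sup>+m. indicator {1..2} m * T m x y x' \<partial>lborel)
      \<le> ennreal (5 powr (1 + s)) * (\<integral>\<^sup>+y'. ennreal ((u (x, y) - u (x', y'))\<^sup>2 / norm (x - x', y - y') powr (2 + 2 * s)) \<partial>lborel)"
    for x y x'
  \<comment> \<open>No slope is defined for equal abscissae, but there the left side is \<open>0\<close> because division by \<open>0\<close> yields \<open>0\<close>.\<close>
  proof (cases "x = x'")
    case True
    then show ?thesis by (simp add: T_def)
  next
    case False
    define d where "d = x' - x"
    have d: "d \<noteq> 0" "x' = x + d" using False by (auto simp: d_def)
    have "(\<integral>\<^sup>+m. indicator {1..2} m * T m x y x' \<partial>lborel)
       \<le> (\<integral>\<^sup>+m. ennreal (5 powr (1 + s)) * (ennreal \<bar>d\<bar> * ennreal ((u (x, y) - u (x', y + d * m))\<^sup>2 / norm (x - x', y - (y + d * m)) powr (2 + 2 * s))) \<partial>lborel)"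
    proof (rule nn_integral_mono)
      fix m :: real
      have neg: "norm (- d, - (d * m)) = norm (d, m * d)" by (simp add: norm_Pair mult.commute)
      show "indicator {1..2} m * T m x y x'
        \<le> ennreal (5 powr (1 + s)) * (ennreal \<bar>d\<bar> * ennreal ((u (x, y) - u (x', y + d * m))\<^sup>2 / norm (x - x', y - (y + d * m)) powr (2 + 2 * s)))"
      proof (cases "m \<in> {1..2}")
        case m: True
        show ?thesis
          using m d sheared_kernel_bound[of m d s "(u (x, y) - u (x', y + m * d))\<^sup>2"] s neg
          by (simp add: T_def ennreal_mult'[symmetric] mult.commute[of d m] ennreal_leI)
      qed auto
    qed
    also have "\<dots> = ennreal (5 powr (1 + s)) * (ennreal \<bar>d\<bar> * (\<integral>\<^sup>+m. ennreal ((u (x, y) - u (x', y + d * m))\<^sup>2 / norm (x - x', y - (y + d * m)) powr (2 + 2 * s)) \<partial>lborel))"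
      by (simp add: nn_integral_cmult)
    also have "ennreal \<bar>d\<bar> * (\<integral>\<^sup>+m. ennreal ((u (x, y) - u (x', y + d * m))\<^sup>2 / norm (x - x', y - (y + d * m)) powr (2 + 2 * s)) \<partial>lborel)
      = (\<integral>\<^sup>+y'. ennreal ((u (x, y) - u (x', y'))\<^sup>2 / norm (x - x', y - y') powr (2 + 2 * s)) \<partial>lborel)"
      by (rule nn_integral_real_affine[symmetric]) (use d in auto)
    finally show ?thesis .
  qed
  have shear: "(\<integral>\<^sup>+c. \<integral>\<^sup>+x. line_energy s (\<lambda>x. u (x, c + m * x)) x \<partial>lborel \<partial>lborel)
      = (\<integral>\<^sup>+x. \<integral>\<^sup>+y. \<integral>\<^sup>+x'. T m x y x' \<partial>lborel \<partial>lborel \<partial>lborel)" for m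
  proof -
    have "(\<integral>\<^sup>+c. \<integral>\<^sup>+x. line_energy s (\<lambda>x. u (x, c + m * x)) x \<partial>lborel \<partial>lborel)
      = (\<integral>\<^sup>+c. \<integral>\<^sup>+x. \<integral>\<^sup>+x'. T m x (c + m * x) x' \<partial>lborel \<partial>lborel \<partial>lborel)"
      by (simp add: line_energy_def T_def algebra_simps)
    also have "\<dots> = (\<integral>\<^sup>+x. \<integral>\<^sup>+c. \<integral>\<^sup>+x'. T m x (c + m * x) x' \<partial>lborel \<partial>lborel \<partial>lborel)"
      unfolding T_def by (rule lborel_pair.Fubini') measurable
    also have "\<dots> = (\<integral>\<^sup>+x. \<integral>\<^sup>+y. \<integral>\<^sup>+x'. T m x y x' \<partial>lborel \<partial>lborel \<partial>lborel)"
    proof (rule nn_integral_cong)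
      fix x
      have "(\<lambda>y. \<integral>\<^sup>+x'. T m x y x' \<partial>lborel) \<in> borel_measurable borel"
      proof -
        have "(\<lambda>y. \<integral>\<^sup>+x'. T m x y x' \<partial>lborel) \<in> borel_measurable lborel"
          unfolding T_def by measurable
        then show ?thesis by simp
      qed
      from nn_integral_real_affine[OF this, of 1 "m * x"]
      show "(\<integral>\<^sup>+c. \<integral>\<^sup>+x'. T m x (c + m * x) x' \<partial>lborel \<partial>lborel) = (\<integral>\<^sup>+y. \<integral>\<^sup>+x'. T m x y x' \<partial>lborel \<partial>lborel)"
        by (simp add: add.commute)
    qed
    finally show ?thesis .
  qed
  have "(\<integral>\<^sup>+m. indicator {1..2} m * (\<integral>\<^sup>+c. \<integral>\<^sup>+x. line_energy s (\<lambda>x. u (x, c + m * x)) x \<partial>lborel \<partial>lborel) \<partial>lborel)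
     = (\<integral>\<^sup>+m. \<integral>\<^sup>+x. \<integral>\<^sup>+y. \<integral>\<^sup>+x'. indicator {1..2} m * T m x y x' \<partial>lborel \<partial>lborel \<partial>lborel \<partial>lborel)"
  proof (rule nn_integral_cong)
    fix m
    show "indicator {1..2} m * (\<integral>\<^sup>+c. \<integral>\<^sup>+x. line_energy s (\<lambda>x. u (x, c + m * x)) x \<partial>lborel \<partial>lborel)
      = (\<integral>\<^sup>+x. \<integral>\<^sup>+y. \<integral>\<^sup>+x'. indicator {1..2} m * T m x y x' \<partial>lborel \<partial>lborel \<partial>lborel)"
      unfolding shear by (cases "m \<in> {1..2}") auto
  qed
  also have "\<dots> = (\<integral>\<^sup>+x. \<integral>\<^sup>+m. \<integral>\<^sup>+y. \<integral>\<^sup>+x'. indicator {1..2} m * T m x y x' \<partial>lborel \<partial>lborel \<partial>lborel \<partial>lborel)"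
    unfolding T_def by (rule lborel_pair.Fubini') measurable
  also have "\<dots> = (\<integral>\<^sup>+x. \<integral>\<^sup>+y. \<integral>\<^sup>+m. \<integral>\<^sup>+x'. indicator {1..2} m * T m x y x' \<partial>lborel \<partial>lborel \<partial>lborel \<partial>lborel)"
    unfolding T_def by (intro nn_integral_cong lborel_pair.Fubini') measurable
  also have "\<dots> = (\<integral>\<^sup>+x. \<integral>\<^sup>+y. \<integral>\<^sup>+x'. \<integral>\<^sup>+m. indicator {1..2} m * T m x y x' \<partial>lborel \<partial>lborel \<partial>lborel \<partial>lborel)"
    unfolding T_def by (intro nn_integral_cong lborel_pair.Fubini') measurable
  also have "\<dots> \<le> (\<integral>\<^sup>+x. \<integral>\<^sup>+y. \<integral>\<^sup>+x'. ennreal (5 powr (1 + s)) *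
      (\<integral>\<^sup>+y'. ennreal ((u (x, y) - u (x', y'))\<^sup>2 / norm (x - x', y - y') powr (2 + 2 * s)) \<partial>lborel) \<partial>lborel \<partial>lborel \<partial>lborel)"
    by (intro nn_integral_mono slope)
  also have "\<dots> = ennreal (5 powr (1 + s)) * gagliardo_energy s u"
    unfolding gagliardo_energy_plane[OF u] by (simp add: nn_integral_cmult)
  finally show ?thesis .
qed

text \<open>The mass of \<open>u\<close> is the integral of its masses along the lines of any fixed slope, so
  averaging over the slopes in \<open>[1, 2]\<close> gives it back.\<close>

lemma fractional_poincare_by_slicing:
  fixes u :: "real \<times> real \<Rightarrow> real"
  assumes u: "u \<in> borel_measurable borel" and s: "1/2 < s" "s < 1" and L: "0 < L"
    and lip: "\<And>z w. \<bar>u z - u w\<bar> \<le> B * norm (z - w)" and B: "0 \<le> B"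
    and zeros: "\<And>c m a. 1 \<le> m \<Longrightarrow> m \<le> 2 \<Longrightarrow> \<exists>x\<in>{a..a + L}. u (x, c + m * x) = 0"
  shows "(\<integral>\<^sup>+z. ennreal ((u z)\<^sup>2) \<partial>lborel)
       \<le> ennreal (hardy_const s L) * (ennreal (5 powr (1 + s)) * gagliardo_energy s u)"
proof -
  note [measurable] = u
  have mass: "(\<integral>\<^sup>+z. ennreal ((u z)\<^sup>2) \<partial>lborel) = (\<integral>\<^sup>+c. \<integral>\<^sup>+x. ennreal ((u (x, c + m * x))\<^sup>2) \<partial>lborel \<partial>lborel)" for m
  proof -
    have "(\<integral>\<^sup>+z. ennreal ((u z)\<^sup>2) \<partial>lborel) = (\<integral>\<^sup>+x. \<integral>\<^sup>+y. ennreal ((u (x, y))\<^sup>2) \<partial>lborel \<partial>lborel)"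
      by (rule nn_integral_lborel_plane) measurable
    also have "\<dots> = (\<integral>\<^sup>+x. \<integral>\<^sup>+c. ennreal ((u (x, c + m * x))\<^sup>2) \<partial>lborel \<partial>lborel)"
    proof (rule nn_integral_cong)
      fix x
      show "(\<integral>\<^sup>+y. ennreal ((u (x, y))\<^sup>2) \<partial>lborel) = (\<integral>\<^sup>+c. ennreal ((u (x, c + m * x))\<^sup>2) \<partial>lborel)"
        using nn_integral_real_affine[of "\<lambda>y. ennreal ((u (x, y))\<^sup>2)" 1 "m * x"]
        by (simp add: add.commute)
    qed
    also have "\<dots> = (\<integral>\<^sup>+c. \<integral>\<^sup>+x. ennreal ((u (x, c + m * x))\<^sup>2) \<partial>lborel \<partial>lborel)"
      by (rule lborel_pair.Fubini') measurable
    finally show ?thesis .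
  qed
  have "(\<integral>\<^sup>+z. ennreal ((u z)\<^sup>2) \<partial>lborel)
      = (\<integral>\<^sup>+m. (\<integral>\<^sup>+z. ennreal ((u z)\<^sup>2) \<partial>lborel) * indicator {1..2::real} m \<partial>lborel)"
    by (simp add: nn_integral_cmult_indicator)
  also have "\<dots> = (\<integral>\<^sup>+m. indicator {1..2} m * (\<integral>\<^sup>+c. \<integral>\<^sup>+x. ennreal ((u (x, c + m * x))\<^sup>2) \<partial>lborel \<partial>lborel) \<partial>lborel)"
    using mass by (simp add: mult.commute)
  also have "\<dots> \<le> (\<integral>\<^sup>+m. indicator {1..2} m * (\<integral>\<^sup>+c. ennreal (hardy_const s L) *
      (\<integral>\<^sup>+x. line_energy s (\<lambda>x. u (x, c + m * x)) x \<partial>lborel) \<partial>lborel) \<partial>lborel)"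
  proof (rule nn_integral_mono)
    fix m :: real
    show "indicator {1..2} m * (\<integral>\<^sup>+c. \<integral>\<^sup>+x. ennreal ((u (x, c + m * x))\<^sup>2) \<partial>lborel \<partial>lborel)
      \<le> indicator {1..2} m * (\<integral>\<^sup>+c. ennreal (hardy_const s L) *
      (\<integral>\<^sup>+x. line_energy s (\<lambda>x. u (x, c + m * x)) x \<partial>lborel) \<partial>lborel)"
    proof (cases "m \<in> {1..2}")
      case m: True
      have "(\<integral>\<^sup>+x. ennreal ((u (x, c + m * x))\<^sup>2) \<partial>lborel)
         \<le> ennreal (hardy_const s L) * (\<integral>\<^sup>+x. line_energy s (\<lambda>x. u (x, c + m * x)) x \<partial>lborel)" for c
      proof (rule fractional_poincare_line[OF _ s L, where K = "B * 3"])
        fix x y :: real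
        have "norm (x - y, m * (x - y)) \<le> \<bar>x - y\<bar> + m * \<bar>x - y\<bar>"
          using m norm_Pair_le[of "x - y" "m * (x - y)"] by (simp add: abs_mult)
        also have "\<dots> \<le> 3 * \<bar>x - y\<bar>"
          using m mult_right_mono[of m 2 "\<bar>x - y\<bar>"] by auto
        finally have "B * norm (x - y, m * (x - y)) \<le> B * (3 * \<bar>x - y\<bar>)"
          using B by (rule mult_left_mono)
        then show "\<bar>u (x, c + m * x) - u (y, c + m * y)\<bar> \<le> B * 3 * \<bar>x - y\<bar>"
          using lip[of "(x, c + m * x)" "(y, c + m * y)"] by (simp add: algebra_simps)
      qed (use zeros m in auto)
      then show ?thesis by (intro mult_left_mono nn_integral_mono) auto
    qed auto
  qed
  also have "\<dots> = ennreal (hardy_const s L) * (\<integral>\<^sup>+m. indicator {1..2} m *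
      (\<integral>\<^sup>+c. \<integral>\<^sup>+x. line_energy s (\<lambda>x. u (x, c + m * x)) x \<partial>lborel \<partial>lborel) \<partial>lborel)"
    unfolding line_energy_def
    by (simp add: nn_integral_cmult mult.left_commute[of "indicator _ _"])
  also have "\<dots> \<le> ennreal (hardy_const s L) * (ennreal (5 powr (1 + s)) * gagliardo_energy s u)"
    using s by (intro mult_left_mono slope_energy_le_gagliardo_energy u) auto
  finally show ?thesis .
qed

section \<open>Regularity and finite energy of test functions\<close>

lemma test_functionD:
  assumes "\<phi> \<in> test_functions \<Omega>"
  shows "\<phi> differentiable (at x)"
    and "b \<in> Basis \<Longrightarrow> (\<lambda>x. frechet_derivative \<phi> (at x) b) differentiable_on UNIV"
    and "compact (closure {x. \<phi> x \<noteq> 0})"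
    and "x \<notin> \<Omega> \<Longrightarrow> \<phi> x = 0"
proof -
  have "times_diff (Suc (Suc 0)) \<phi>"
    using assms unfolding test_functions_def smooth_def by blast
  then show "\<phi> differentiable (at x)"
    and "b \<in> Basis \<Longrightarrow> (\<lambda>x. frechet_derivative \<phi> (at x) b) differentiable_on UNIV"
    by (simp_all add: differentiable_on_def)
  show "compact (closure {x. \<phi> x \<noteq> 0})" "x \<notin> \<Omega> \<Longrightarrow> \<phi> x = 0"
    using assms closure_subset[of "{x. \<phi> x \<noteq> 0}"] by (auto simp: test_functions_def)
qed

lemma test_function_continuous:
  assumes "\<phi> \<in> test_functions \<Omega>"
  shows "continuous_on S \<phi>"
  using test_functionD(1)[OF assms]
  by (intro differentiable_imp_continuous_on) (auto simp: differentiable_on_def intro: differentiable_at_withinI)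

lemma test_function_borel_measurable:
  "\<phi> \<in> test_functions \<Omega> \<Longrightarrow> \<phi> \<in> borel_measurable borel"
  by (intro borel_measurable_continuous_onI test_function_continuous)

lemma test_function_bounded:
  assumes "\<phi> \<in> test_functions \<Omega>"
  obtains M where "0 \<le> M" "\<And>x. \<bar>\<phi> x\<bar> \<le> M"
proof -
  let ?S = "closure {x. \<phi> x \<noteq> 0}"
  have "compact (\<phi> ` ?S)"
    by (intro compact_continuous_image test_functionD(3)[OF assms] test_function_continuous[OF assms])
  from compact_imp_bounded[OF this] obtain M where M: "0 < M" "\<And>y. y \<in> \<phi> ` ?S \<Longrightarrow> norm y \<le> M"
    unfolding bounded_pos by blast
  have bound: "\<bar>\<phi> x\<bar> \<le> M" for x
  proof (cases "\<phi> x = 0")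
    case False
    then have "x \<in> ?S" using closure_subset[of "{x. \<phi> x \<noteq> 0}"] by auto
    then show ?thesis using M(2)[of "\<phi> x"] by auto
  qed (use M in auto)
  show thesis by (rule that[OF less_imp_le[OF M(1)] bound])
qed

text \<open>The partial derivatives are continuous, being differentiable, and vanish off the compact support, so
  they are bounded.\<close>

lemma test_function_Lipschitz:
  fixes \<phi> :: "'a::euclidean_space \<Rightarrow> real"
  assumes \<phi>: "\<phi> \<in> test_functions \<Omega>"
  obtains B where "0 \<le> B" "\<And>x y. \<bar>\<phi> x - \<phi> y\<bar> \<le> B * norm (x - y)"
proof -
  let ?S = "closure {x. \<phi> x \<noteq> 0}"
  let ?D = "\<lambda>x. frechet_derivative \<phi> (at x)"
  have D: "(\<phi> has_derivative ?D x) (at x)" for x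
    using test_functionD(1)[OF \<phi>] frechet_derivative_works by blast
  have outside: "?D x b = 0" if "x \<notin> ?S" for x b
  proof -
    have "((\<lambda>x. 0) has_derivative (\<lambda>h. 0)) (at x)" by simp
    then have "(\<phi> has_derivative (\<lambda>h. 0)) (at x)"
    proof (rule has_derivative_transform_within_open)
      show "open (- ?S)" "x \<in> - ?S" using that by auto
      show "0 = \<phi> y" if "y \<in> - ?S" for y
        using that closure_subset[of "{x. \<phi> x \<noteq> 0}"] by auto
    qed
    from has_derivative_unique[OF D this] show ?thesis by simp
  qed
  have "\<forall>b\<in>Basis. \<exists>M. 0 \<le> M \<and> (\<forall>x. \<bar>?D x b\<bar> \<le> M)"
  proof
    fix b :: 'a assume b: "b \<in> Basis"
    have "continuous_on ?S (\<lambda>x. ?D x b)"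
      by (rule continuous_on_subset[OF differentiable_imp_continuous_on[OF test_functionD(2)[OF \<phi> b]]]) simp
    then have "bounded ((\<lambda>x. ?D x b) ` ?S)"
      by (intro compact_imp_bounded compact_continuous_image test_functionD(3)[OF \<phi>])
    then obtain M where M: "0 < M" "\<And>x. x \<in> ?S \<Longrightarrow> norm (?D x b) \<le> M"
      unfolding bounded_pos by auto
    have "\<bar>?D x b\<bar> \<le> M" for x using M outside[of x b] by (cases "x \<in> ?S") auto
    then show "\<exists>M. 0 \<le> M \<and> (\<forall>x. \<bar>?D x b\<bar> \<le> M)" using M(1) by (intro exI[of _ M]) auto
  qed
  from bchoice[OF this] obtain M where M: "\<And>b. b \<in> Basis \<Longrightarrow> 0 \<le> M b" "\<And>b x. b \<in> Basis \<Longrightarrow> \<bar>?D x b\<bar> \<le> M b"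
    by blast
  have "onorm (?D x) \<le> (\<Sum>b\<in>Basis. M b)" for x
  proof -
    have "onorm (?D x) \<le> (\<Sum>b\<in>Basis. norm (?D x b))"
      by (rule onorm_componentwise[OF has_derivative_bounded_linear[OF D]])
    also have "\<dots> \<le> (\<Sum>b\<in>Basis. M b)" using M(2) by (intro sum_mono) auto
    finally show ?thesis .
  qed
  then have Lip: "\<bar>\<phi> x - \<phi> y\<bar> \<le> (\<Sum>b\<in>Basis. M b) * norm (x - y)" for x y
    using differentiable_bound[of UNIV \<phi> ?D "\<Sum>b\<in>Basis. M b" x y] D by auto
  show thesis by (rule that[OF _ Lip]) (simp add: M(1) sum_nonneg)
qed

text \<open>A square root of the radial profile \<open>min(1, \<rho>\<^sup>2) / \<rho> powr (2 + 2 s)\<close> which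
  dominates the energy density of a bounded Lipschitz function. As it decreases, its square at \<open>norm (h, k)\<close>
  is at most the product of its values at \<open>\<bar>h\<bar>\<close> and \<open>\<bar>k\<bar>\<close>, which turns
  integrability in the plane into integrability on the line and avoids polar coordinates.\<close>

definition radial_kernel :: "real \<Rightarrow> real \<Rightarrow> real" where
  "radial_kernel s \<rho> = min 1 \<rho> / \<rho> powr (1 + s)"

lemma radial_kernel_nonneg: "0 \<le> \<rho> \<Longrightarrow> 0 \<le> radial_kernel s \<rho>"
  by (simp add: radial_kernel_def)

lemma radial_kernel_eq:
  "0 < \<rho> \<Longrightarrow> radial_kernel s \<rho> = (if \<rho> \<le> 1 then \<rho> powr (- s) else \<rho> powr (-(1 + s)))"
  unfolding radial_kernel_def powr_minus_divide by (auto simp: powr_add min_def)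

lemma radial_kernel_antimono:
  assumes s: "0 < s" and ab: "0 < a" "a \<le> b"
  shows "radial_kernel s b \<le> radial_kernel s a"
proof -
  have "b powr (-(1 + s)) \<le> a powr (- s)" if "a \<le> 1" "1 < b"
  proof -
    have "b powr (-(1 + s)) \<le> 1 powr (-(1 + s))" using that s by (intro powr_mono2') auto
    also have "\<dots> = 1 powr (- s)" by simp
    also have "\<dots> \<le> a powr (- s)" using that s ab by (intro powr_mono2') auto
    finally show ?thesis .
  qed
  then show ?thesis using assms by (auto simp: radial_kernel_eq intro!: powr_mono2')
qed

lemma nn_integral_radial_kernel_finite:
  assumes s: "0 < s" "s < 1"
  shows "(\<integral>\<^sup>+t. ennreal (radial_kernel s \<bar>t\<bar>) \<partial>lborel) < \<infinity>"
proof -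
  let ?k = "\<lambda>t. ennreal (t powr (- s)) * indicator {0..1} t + ennreal (t powr (-(1 + s))) * indicator {1..} t"
  have "(\<integral>\<^sup>+t. ?k t \<partial>lborel) = (\<integral>\<^sup>+t. ennreal (t powr (- s)) * indicator {0..1} t \<partial>lborel)
      + (\<integral>\<^sup>+t. ennreal (t powr (-(1 + s))) * indicator {1..} t \<partial>lborel)"
    by (rule nn_integral_add) measurable
  also have "(\<integral>\<^sup>+t. ennreal (t powr (- s)) * indicator {0..1} t \<partial>lborel) = ennreal (1 / (1 - s))"
    using nn_integral_has_integral_lebesgue'[OF _ has_integral_powr_from_0[of "- s" 1]] s by simp
  also have "(\<integral>\<^sup>+t. ennreal (t powr (-(1 + s))) * indicator {1..} t \<partial>lborel) = ennreal (1 / s)"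
    using nn_integral_powr_tail[of 1 "s / 2"] s by simp
  finally have fin: "(\<integral>\<^sup>+t. ?k t \<partial>lborel) < \<infinity>" by simp
  have refl: "(\<integral>\<^sup>+t. ?k (- t) \<partial>lborel) = (\<integral>\<^sup>+t. ?k t \<partial>lborel)"
    using nn_integral_real_affine[of ?k "-1" 0] by simp
  have "(\<integral>\<^sup>+t. ennreal (radial_kernel s \<bar>t\<bar>) \<partial>lborel) \<le> (\<integral>\<^sup>+t. ?k t + ?k (- t) \<partial>lborel)"
  proof (rule nn_integral_mono)
    fix t :: real
    show "ennreal (radial_kernel s \<bar>t\<bar>) \<le> ?k t + ?k (- t)"
    proof (cases "t = 0")
      case False
      then have "0 < \<bar>t\<bar>" by simp
      then show ?thesis using False
        by (auto simp: radial_kernel_eq indicator_def abs_if)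
    qed (simp add: radial_kernel_def)
  qed
  also have "\<dots> = (\<integral>\<^sup>+t. ?k t \<partial>lborel) + (\<integral>\<^sup>+t. ?k (- t) \<partial>lborel)"
    by (rule nn_integral_add) measurable
  also have "\<dots> < \<infinity>" using fin unfolding refl by simp
  finally show ?thesis .
qed

lemma min_square_kernel_le:
  fixes h k s :: real
  assumes s: "0 < s" and nz: "h \<noteq> 0" "k \<noteq> 0"
  shows "min 1 ((norm (h, k))\<^sup>2) / norm (h, k) powr (2 + 2 * s) \<le> radial_kernel s \<bar>h\<bar> * radial_kernel s \<bar>k\<bar>"
proof -
  let ?\<rho> = "norm (h, k)"
  have \<rho>: "\<bar>h\<bar> \<le> ?\<rho>" "\<bar>k\<bar> \<le> ?\<rho>" "0 < ?\<rho>"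
    using norm_fst_le[of h k] norm_snd_le[of k h] nz by (auto simp: zero_prod_def)
  have "min 1 (?\<rho>\<^sup>2) = (min 1 ?\<rho>)\<^sup>2"
    using \<rho>(3) power_mono[of 1 ?\<rho> 2] power_mono[of ?\<rho> 1 2] by (auto simp: min_def)
  moreover have "?\<rho> powr (2 + 2 * s) = (?\<rho> powr (1 + s))\<^sup>2"
    using \<rho>(3) by (simp add: powr_power algebra_simps)
  ultimately have "min 1 (?\<rho>\<^sup>2) / ?\<rho> powr (2 + 2 * s) = radial_kernel s ?\<rho> * radial_kernel s ?\<rho>"
    by (simp add: radial_kernel_def power2_eq_square)
  also have "\<dots> \<le> radial_kernel s \<bar>h\<bar> * radial_kernel s \<bar>k\<bar>"
    using \<rho> nz s by (intro mult_mono radial_kernel_antimono) (auto simp: radial_kernel_def)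
  finally show ?thesis .
qed

lemma emeasure_support_finite:
  assumes "\<phi> \<in> test_functions \<Omega>"
  shows "emeasure lborel (closure {x. \<phi> x \<noteq> 0}) < \<infinity>"
  using test_functionD(3)[OF assms] by (intro emeasure_bounded_finite compact_imp_bounded)

lemma test_function_L2_finite:
  assumes \<phi>: "\<phi> \<in> test_functions \<Omega>"
  shows "(\<integral>\<^sup>+x. ennreal ((\<phi> x)\<^sup>2) \<partial>lborel) < \<infinity>"
proof -
  let ?S = "closure {x. \<phi> x \<noteq> 0}"
  obtain M where M: "0 \<le> M" "\<And>x. \<bar>\<phi> x\<bar> \<le> M" using test_function_bounded[OF \<phi>] by blast
  have "(\<phi> x)\<^sup>2 \<le> M\<^sup>2" for x using M abs_le_square_iff[of "\<phi> x" M] by auto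
  then have "(\<integral>\<^sup>+x. ennreal ((\<phi> x)\<^sup>2) \<partial>lborel) \<le> (\<integral>\<^sup>+x. ennreal (M\<^sup>2) * indicator ?S x \<partial>lborel)"
    using closure_subset[of "{x. \<phi> x \<noteq> 0}"]
    by (intro nn_integral_mono) (auto simp: indicator_def ennreal_leI split: if_splits)
  also have "\<dots> < \<infinity>"
    using emeasure_support_finite[OF \<phi>] by (simp add: nn_integral_cmult_indicator ennreal_mult_less_top)
  finally show ?thesis .
qed

text \<open>Only pairs with at least one point in the support contribute, and for these the integral over the
  other point is bounded by the square of the integral of the radial kernel.\<close>

lemma test_function_energy_finite:
  fixes \<phi> :: "real \<times> real \<Rightarrow> real"
  assumes \<phi>: "\<phi> \<in> test_functions \<Omega>" and s: "0 < s" "s < 1"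
  shows "gagliardo_energy s \<phi> < \<infinity>"
proof -
  let ?S = "closure {x. \<phi> x \<noteq> 0}"
  define k where "k t = ennreal (radial_kernel s \<bar>t\<bar>)" for t :: real
  define G where "G z w = k (fst w - fst z) * k (snd w - snd z)" for z w :: "real \<times> real"
  have k [measurable]: "k \<in> borel_measurable borel"
    unfolding k_def radial_kernel_def by measurable
  have [measurable]: "(fst :: real \<times> real \<Rightarrow> real) \<in> borel_measurable borel"
      "(snd :: real \<times> real \<Rightarrow> real) \<in> borel_measurable borel"
    by (intro borel_measurable_continuous_onI continuous_intros)+
  have G [measurable]: "case_prod G \<in> borel_measurable (borel \<Otimes>\<^sub>M borel)"
    unfolding G_def by measurable
  have [measurable]: "?S \<in> sets borel" by (intro borel_closed closed_closure)
  define H where "H z = (\<integral>\<^sup>+w. indicator ?S w * G z w \<partial>lborel)" for z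
  have H [measurable]: "H \<in> borel_measurable lborel"
    unfolding H_def by measurable
  define I where "I = (\<integral>\<^sup>+t. k t \<partial>lborel)"
  have I: "I < \<infinity>" using nn_integral_radial_kernel_finite[OF s] by (simp add: I_def k_def)
  have shift: "(\<integral>\<^sup>+t. k (t - a) \<partial>lborel) = I" for a
    using nn_integral_real_affine[of k 1 "- a"] by (simp add: I_def)
  have G_int: "(\<integral>\<^sup>+w. G z w \<partial>lborel) = I * I" for z
    unfolding G_def
    by (subst nn_integral_lborel_plane) (auto simp: nn_integral_cmult nn_integral_multc shift)
  have G_int': "(\<integral>\<^sup>+z. G z w \<partial>lborel) = I * I" for w
    using G_int[of w] by (simp add: G_def k_def abs_minus_commute)
  obtain M where M: "0 \<le> M" "\<And>x. \<bar>\<phi> x\<bar> \<le> M" using test_function_bounded[OF \<phi>] by blast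
  obtain B where B: "0 \<le> B" "\<And>x y. \<bar>\<phi> x - \<phi> y\<bar> \<le> B * norm (x - y)"
    using test_function_Lipschitz[OF \<phi>] by blast
  define N where "N = (2 * M + B)\<^sup>2"
  have N: "0 \<le> N" by (simp add: N_def)
  have diff: "(\<phi> z - \<phi> w)\<^sup>2 \<le> N * min 1 ((norm (z - w))\<^sup>2)" for z w
  proof -
    have "\<bar>\<phi> z - \<phi> w\<bar> \<le> 2 * M + B" using M(2)[of z] M(2)[of w] B(1) by auto
    then have 1: "(\<phi> z - \<phi> w)\<^sup>2 \<le> N"
      unfolding N_def using abs_le_square_iff[of "\<phi> z - \<phi> w" "2 * M + B"] by auto
    have "\<bar>\<phi> z - \<phi> w\<bar> \<le> (2 * M + B) * norm (z - w)"
      using B(2)[of z w] M(1) by (smt (verit) mult_right_mono norm_ge_zero)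
    then have 2: "(\<phi> z - \<phi> w)\<^sup>2 \<le> N * (norm (z - w))\<^sup>2"
      unfolding N_def power_mult_distrib[symmetric]
      using abs_le_square_iff[of "\<phi> z - \<phi> w" "(2 * M + B) * norm (z - w)"] by auto
    show ?thesis using 1 2 by (auto simp: min_def)
  qed
  have bound: "ennreal ((\<phi> z - \<phi> w)\<^sup>2 / norm (z - w) powr (2 + 2 * s))
      \<le> ennreal N * (indicator ?S z * G z w + indicator ?S w * G z w)"
    if nz: "fst w \<noteq> fst z" "snd w \<noteq> snd z" for z w
  proof (cases "z \<in> ?S \<or> w \<in> ?S")
    case True
    have "norm (z - w) = norm (fst w - fst z, snd w - snd z)"
      by (metis norm_minus_commute prod.collapse diff_Pair)
    then have kernel: "min 1 ((norm (z - w))\<^sup>2) / norm (z - w) powr (2 + 2 * s)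
        \<le> radial_kernel s \<bar>fst w - fst z\<bar> * radial_kernel s \<bar>snd w - snd z\<bar>"
      using nz s min_square_kernel_le[of s "fst w - fst z" "snd w - snd z"] by simp
    have "(\<phi> z - \<phi> w)\<^sup>2 / norm (z - w) powr (2 + 2 * s)
        \<le> N * (min 1 ((norm (z - w))\<^sup>2) / norm (z - w) powr (2 + 2 * s))"
      using divide_right_mono[OF diff[of z w], of "norm (z - w) powr (2 + 2 * s)"] by simp
    also have "\<dots> \<le> N * (radial_kernel s \<bar>fst w - fst z\<bar> * radial_kernel s \<bar>snd w - snd z\<bar>)"
      by (intro mult_left_mono kernel) (rule N)
    finally have "ennreal ((\<phi> z - \<phi> w)\<^sup>2 / norm (z - w) powr (2 + 2 * s)) \<le> \<dots>"
      by (rule ennreal_leI)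
    also have "\<dots> = ennreal N * G z w"
      by (simp add: G_def k_def ennreal_mult N radial_kernel_nonneg)
    also have "\<dots> \<le> ennreal N * (indicator ?S z * G z w + indicator ?S w * G z w)"
      using True by (intro mult_left_mono) (auto simp: indicator_def)
    finally show ?thesis .
  next
    case False
    then have "\<phi> z = 0" "\<phi> w = 0" using closure_subset[of "{x. \<phi> x \<noteq> 0}"] by auto
    then show ?thesis by simp
  qed
  \<comment> \<open>The product bound of the kernel needs both coordinates of \<open>z - w\<close> to be nonzero, as \<open>radial_kernel s 0 = 0\<close>.\<close>
  have ae: "AE w in lborel. fst w \<noteq> fst z \<and> snd w \<noteq> snd z" for z :: "real \<times> real"
  proof -
    have "AE p in (lborel :: real measure) \<Otimes>\<^sub>M (lborel :: real measure). fst p \<noteq> fst z \<and> snd p \<noteq> snd z"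
    proof (rule lborel_pair.AE_pair_measure)
      show "AE x in lborel. AE y in lborel. fst (x, y) \<noteq> fst z \<and> snd (x, y) \<noteq> snd z"
        using AE_lborel_singleton[of "fst z"] AE_lborel_singleton[of "snd z"]
        by (auto elim!: eventually_mono)
    qed measurable
    then show ?thesis unfolding lborel_prod .
  qed
  have "gagliardo_energy s \<phi> = (\<integral>\<^sup>+z. \<integral>\<^sup>+w. ennreal ((\<phi> z - \<phi> w)\<^sup>2 / norm (z - w) powr (2 + 2 * s)) \<partial>lborel \<partial>lborel)"
    by (simp add: gagliardo_energy_lborel)
  also have "\<dots> \<le> (\<integral>\<^sup>+z. \<integral>\<^sup>+w. ennreal N * (indicator ?S z * G z w + indicator ?S w * G z w) \<partial>lborel \<partial>lborel)"
  proof (rule nn_integral_mono, rule nn_integral_mono_AE)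
    fix z
    show "AE w in lborel. ennreal ((\<phi> z - \<phi> w)\<^sup>2 / norm (z - w) powr (2 + 2 * s))
        \<le> ennreal N * (indicator ?S z * G z w + indicator ?S w * G z w)"
      using ae[of z]
    proof eventually_elim
      case (elim w)
      then show ?case by (intro bound) simp_all
    qed
  qed
  also have "\<dots> = (\<integral>\<^sup>+z. ennreal N * (I * I * indicator ?S z + H z) \<partial>lborel)"
    unfolding H_def by (simp add: nn_integral_cmult nn_integral_add G_int mult.commute[of "I * I"])
  also have "\<dots> = ennreal N * (I * I * emeasure lborel ?S + (\<integral>\<^sup>+z. H z \<partial>lborel))"
    by (simp add: nn_integral_cmult nn_integral_add)
  also have "(\<integral>\<^sup>+z. H z \<partial>lborel) = (\<integral>\<^sup>+w. \<integral>\<^sup>+z. indicator ?S w * G z w \<partial>lborel \<partial>lborel)"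
    unfolding H_def by (rule lborel_pair.Fubini') measurable
  also have "\<dots> = (\<integral>\<^sup>+w. I * I * indicator ?S w \<partial>lborel)"
    by (simp add: nn_integral_cmult G_int' mult.commute[of "I * I"])
  also have "\<dots> = I * I * emeasure lborel ?S"
    by (simp add: nn_integral_cmult)
  also have "ennreal N * (I * I * emeasure lborel ?S + I * I * emeasure lborel ?S) < \<infinity>"
    using I emeasure_support_finite[OF \<phi>] by (simp add: ennreal_mult_less_top)
  finally show ?thesis .
qed

section \<open>Lines of moderate slope in the strip domain\<close>

lemma strip_left_step:
  assumes "\<And>j. 0 \<le> \<sigma> j"
  shows "strip_left \<sigma> k + 1 \<le> strip_left \<sigma> (k + 1)"
proof -
  consider "k \<ge> 0" | "k = -1" | "k < -1" by linarith
  then show ?thesis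
  proof cases
    case 1
    then have "{0..k + 1} = insert (k + 1) {0..k}" by auto
    then show ?thesis using 1 assms[of "nat (k + 1)"] by (simp add: strip_left_def)
  next
    case 2
    then show ?thesis using assms[of 0] by (simp add: strip_left_def)
  next
    case 3
    then have "{k + 1..0} = insert (k + 1) {k + 1 + 1..0}" by auto
    then show ?thesis using 3 assms[of "nat (- (k + 1))"] by (simp add: strip_left_def)
  qed
qed

lemma strip_left_gap:
  assumes \<sigma>: "\<And>j. 0 \<le> \<sigma> j" and "j < k"
  shows "strip_left \<sigma> j + 1 \<le> strip_left \<sigma> k"
proof -
  have "strip_left \<sigma> j + 1 \<le> strip_left \<sigma> (j + 1 + int n)" for n
  proof (induction n)
    case (Suc n)
    then show ?case using strip_left_step[of \<sigma> "j + 1 + int n"] \<sigma> by (simp add: add_ac)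
  qed (use strip_left_step[of \<sigma> j] \<sigma> in simp)
  from this[of "nat (k - j - 1)"] show ?thesis using assms(2) by simp
qed

text \<open>If the left end lies in a strip then the right edge of that strip is within distance \<open>1\<close>, and it
  belongs to no strip, as the strips are open and disjoint.\<close>

lemma unit_interval_leaves_strips:
  assumes \<sigma>: "\<And>j. 0 \<le> \<sigma> j"
  shows "\<exists>p\<in>{x..x + 1}. \<forall>k. p \<notin> {strip_left \<sigma> k<..<strip_left \<sigma> k + 1}"
proof (cases "\<exists>k. x \<in> {strip_left \<sigma> k<..<strip_left \<sigma> k + 1}")
  case True
  then obtain k where k: "x \<in> {strip_left \<sigma> k<..<strip_left \<sigma> k + 1}" ..
  have "strip_left \<sigma> k + 1 \<notin> {strip_left \<sigma> j<..<strip_left \<sigma> j + 1}" for j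
    using strip_left_gap[of \<sigma> j k] strip_left_gap[of \<sigma> k j] \<sigma>
    by (cases j k rule: linorder_cases) auto
  then show ?thesis using k by (intro bexI[of _ "strip_left \<sigma> k + 1"]) auto
qed auto

text \<open>If the line meets the horizontal strip above \<open>[a, a + 1]\<close>, it is beyond that strip above
  \<open>[a + 2, a + 3]\<close> because that strip has height \<open>1\<close> and the line rises by at least \<open>1\<close> in between. Hence one of these two unit
  intervals lies off the horizontal strip.\<close>

lemma slanted_line_leaves_strip_domain:
  assumes \<sigma>: "\<And>j. 0 \<le> \<sigma> j" and m: "1 \<le> m"
  shows "\<exists>x\<in>{a..a + 3}. (x, c + m * x) \<notin> strip_domain \<sigma>"
proof (cases "\<exists>x\<in>{a..a + 1}. c + m * x \<in> {-2<..<-1}")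
  case True
  then obtain x where x: "x \<in> {a..a + 1}" "c + m * x > -2" by auto
  obtain p where p: "p \<in> {a + 2..a + 2 + 1}" "\<forall>k. p \<notin> {strip_left \<sigma> k<..<strip_left \<sigma> k + 1}"
    using unit_interval_leaves_strips[of \<sigma>] \<sigma> by blast
  have "m * 1 \<le> m * (p - x)" using p x m by (intro mult_left_mono) auto
  then have "c + m * p \<ge> -1" using x m by (simp add: right_diff_distrib)
  then show ?thesis using p by (intro bexI[of _ p]) (auto simp: strip_domain_def)
next
  case False
  obtain p where p: "p \<in> {a..a + 1}" "\<forall>k. p \<notin> {strip_left \<sigma> k<..<strip_left \<sigma> k + 1}"
    using unit_interval_leaves_strips[of \<sigma>] \<sigma> by blast
  then show ?thesis using False by (intro bexI[of _ p]) (auto simp: strip_domain_def)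
qed

section \<open>From test functions to the closure\<close>

lemma square_le_of_abs_le_add:
  fixes a b c :: real
  assumes "\<bar>c\<bar> \<le> \<bar>a\<bar> + \<bar>b\<bar>"
  shows "c\<^sup>2 \<le> 2 * a\<^sup>2 + 2 * b\<^sup>2"
proof -
  have "c\<^sup>2 \<le> (\<bar>a\<bar> + \<bar>b\<bar>)\<^sup>2" using assms abs_le_square_iff[of c "\<bar>a\<bar> + \<bar>b\<bar>"] by simp
  then show ?thesis using square_sum_le_weighted[of 1 "\<bar>a\<bar>" "\<bar>b\<bar>"] by simp
qed

lemma L2_sq_lborel: "L2_sq \<Omega> u = (\<integral>\<^sup>+x. ennreal ((u x)\<^sup>2) * indicator \<Omega> x \<partial>lborel)"
  by (simp add: L2_sq_def nn_integral_completion)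

lemma L2_sq_le_add:
  assumes "f \<in> borel_measurable borel" "g \<in> borel_measurable borel" "\<Omega> \<in> sets borel"
    and le: "\<And>x. \<bar>h x\<bar> \<le> \<bar>f x\<bar> + \<bar>g x\<bar>"
  shows "L2_sq \<Omega> h \<le> 2 * L2_sq \<Omega> f + 2 * L2_sq \<Omega> g"
proof -
  note [measurable] = assms(1-3)
  have "L2_sq \<Omega> h \<le> (\<integral>\<^sup>+x. 2 * (ennreal ((f x)\<^sup>2) * indicator \<Omega> x) + 2 * (ennreal ((g x)\<^sup>2) * indicator \<Omega> x) \<partial>lborel)"
    unfolding L2_sq_lborel
  proof (rule nn_integral_mono)
    fix x
    have "ennreal ((h x)\<^sup>2) \<le> ennreal (2 * (f x)\<^sup>2 + 2 * (g x)\<^sup>2)"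
      by (intro ennreal_leI square_le_of_abs_le_add le)
    also have "\<dots> = 2 * ennreal ((f x)\<^sup>2) + 2 * ennreal ((g x)\<^sup>2)"
      by (simp add: ennreal_mult)
    finally show "ennreal ((h x)\<^sup>2) * indicator \<Omega> x
        \<le> 2 * (ennreal ((f x)\<^sup>2) * indicator \<Omega> x) + 2 * (ennreal ((g x)\<^sup>2) * indicator \<Omega> x)"
      by (auto simp: indicator_def)
  qed
  also have "\<dots> = 2 * L2_sq \<Omega> f + 2 * L2_sq \<Omega> g"
    unfolding L2_sq_lborel by (simp add: nn_integral_add nn_integral_cmult)
  finally show ?thesis .
qed

lemma gagliardo_energy_le_add:
  fixes f g h :: "'a::euclidean_space \<Rightarrow> real"
  assumes "f \<in> borel_measurable borel" "g \<in> borel_measurable borel"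
    and le: "\<And>x y. \<bar>h x - h y\<bar> \<le> \<bar>f x - f y\<bar> + \<bar>g x - g y\<bar>"
  shows "gagliardo_energy s h \<le> 2 * gagliardo_energy s f + 2 * gagliardo_energy s g"
proof -
  note [measurable] = assms(1,2)
  let ?K = "\<lambda>u z w. ennreal ((u z - u w)\<^sup>2 / norm (z - w) powr (real DIM('a) + 2 * s))"
  have "gagliardo_energy s h \<le> (\<integral>\<^sup>+z. \<integral>\<^sup>+w. 2 * ?K f z w + 2 * ?K g z w \<partial>lborel \<partial>lborel)"
    unfolding gagliardo_energy_lborel
  proof (intro nn_integral_mono)
    fix z w :: 'a
    let ?n = "norm (z - w) powr (real DIM('a) + 2 * s)"
    have "?K h z w \<le> ennreal ((2 * (f z - f w)\<^sup>2 + 2 * (g z - g w)\<^sup>2) / ?n)"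
      by (intro ennreal_leI divide_right_mono square_le_of_abs_le_add le) auto
    also have "\<dots> = ennreal (2 * ((f z - f w)\<^sup>2 / ?n) + 2 * ((g z - g w)\<^sup>2 / ?n))"
      by (simp add: add_divide_distrib)
    also have "\<dots> = 2 * ?K f z w + 2 * ?K g z w"
      by (simp add: ennreal_mult del: times_divide_eq_right)
    finally show "?K h z w \<le> 2 * ?K f z w + 2 * ?K g z w" .
  qed
  also have "\<dots> = 2 * gagliardo_energy s f + 2 * gagliardo_energy s g"
    unfolding gagliardo_energy_lborel by (simp add: nn_integral_add nn_integral_cmult)
  finally show ?thesis .
qed

text \<open>Invariance under changes on null sets allows Lebesgue measurable functions to be replaced by Borel
  ones, for which the iterated integrals can be handled with product measures.\<close>

lemma L2_sq_cong_AE: "AE x in lborel. u x = v x \<Longrightarrow> L2_sq \<Omega> u = L2_sq \<Omega> v"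
  unfolding L2_sq_lborel by (intro nn_integral_cong_AE) auto

lemma gagliardo_energy_cong_AE:
  assumes "AE x in lborel. u x = v x"
  shows "gagliardo_energy s u = gagliardo_energy s v"
  unfolding gagliardo_energy_lborel
proof (rule nn_integral_cong_AE)
  show "AE z in lborel. (\<integral>\<^sup>+w. ennreal ((u z - u w)\<^sup>2 / norm (z - w) powr (real DIM('a) + 2 * s)) \<partial>lborel)
      = (\<integral>\<^sup>+w. ennreal ((v z - v w)\<^sup>2 / norm (z - w) powr (real DIM('a) + 2 * s)) \<partial>lborel)"
    using assms
  proof eventually_elim
    case (elim z)
    show ?case
      using assms by (intro nn_integral_cong_AE) (auto elim!: eventually_mono simp: elim)
  qed
qed

text \<open>Without energy the function is almost everywhere constant, and nonzero constants are not square
  integrable.\<close>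

lemma zero_energy_imp_AE_zero:
  fixes v :: "'a::euclidean_space \<Rightarrow> real"
  assumes v: "v \<in> borel_measurable borel" and zero: "gagliardo_energy s v = 0"
    and fin: "L2_sq UNIV v < \<infinity>"
  shows "AE x in lborel. v x = 0"
proof -
  note [measurable] = v
  let ?K = "\<lambda>z w. ennreal ((v z - v w)\<^sup>2 / norm (z - w) powr (real DIM('a) + 2 * s))"
  have "AE z in lborel. (\<integral>\<^sup>+w. ?K z w \<partial>lborel) = 0"
    using zero unfolding gagliardo_energy_lborel by (subst (asm) nn_integral_0_iff_AE) auto
  then obtain z where z: "(\<integral>\<^sup>+w. ?K z w \<partial>lborel) = 0"
    using eventually_happens by (force simp: ae_filter_eq_bot_iff)
  then have "AE w in lborel. ?K z w = 0" by (subst (asm) nn_integral_0_iff_AE) auto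
  then have const: "AE w in lborel. v w = v z"
    using AE_lborel_singleton[of z]
  proof eventually_elim
    case (elim w)
    then have "(v z - v w)\<^sup>2 / norm (z - w) powr (real DIM('a) + 2 * s) \<le> 0" "0 < norm (z - w)" by auto
    then show ?case by (simp add: divide_le_0_iff)
  qed
  have "L2_sq UNIV v = L2_sq UNIV (\<lambda>_ :: 'a. v z)" by (rule L2_sq_cong_AE) (rule const)
  then have "v z = 0" using fin by (auto simp: L2_sq_lborel ennreal_mult_top split: if_splits)
  with const show ?thesis by simp
qed

text \<open>The mass of \<open>u\<close> is compared with that of a nearby test function, and the energy of the latter with
  that of \<open>u\<close>. Each of the two comparisons costs a factor \<open>2\<close>, hence \<open>4 C\<close>.\<close>

lemma Hs_closure_poincare:
  fixes u :: "real \<times> real \<Rightarrow> real" and C :: real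
  assumes u: "u \<in> Hs_closure \<Omega> s" and s: "0 < s" "s < 1" and C: "0 \<le> C"
    and \<Omega>: "\<Omega> \<in> sets borel"
    and test: "\<And>\<phi>. \<phi> \<in> test_functions \<Omega> \<Longrightarrow> L2_sq \<Omega> \<phi> \<le> ennreal C * gagliardo_energy s \<phi>"
  shows "L2_sq \<Omega> u \<le> ennreal (4 * C) * gagliardo_energy s u"
proof -
  from u have "u \<in> borel_measurable lebesgue" and fin: "L2_sq UNIV u < \<infinity>" "gagliardo_energy s u < \<infinity>"
    by (auto simp: Hs_closure_def Hs_space_def)
  then obtain v where v: "v \<in> borel_measurable borel" and uv: "AE x in lborel. u x = v x"
    using completion_ex_borel_measurable_real[of u lborel] by auto
  obtain \<phi> :: "nat \<Rightarrow> real \<times> real \<Rightarrow> real" where \<phi>: "\<And>m. \<phi> m \<in> test_functions \<Omega>"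
    and lim: "(\<lambda>m. Hs_norm \<Omega> s (\<lambda>x. \<phi> m x - u x)) \<longlonglongrightarrow> 0"
    using u by (auto simp: Hs_closure_def)
  have L2_v: "L2_sq \<Omega> u = L2_sq \<Omega> v" and E_v: "gagliardo_energy s u = gagliardo_energy s v"
    using uv by (rule L2_sq_cong_AE gagliardo_energy_cong_AE)+
  have diff_v: "AE x in lborel. \<phi> m x - u x = \<phi> m x - v x" for m
    using uv by eventually_elim simp
  have "L2_sq \<Omega> v \<le> L2_sq UNIV v"
    unfolding L2_sq_lborel by (intro nn_integral_mono) (auto simp: indicator_def)
  then have L2_v_fin: "L2_sq \<Omega> v < \<infinity>"
    using fin(1) L2_sq_cong_AE[OF uv, of UNIV] by (simp add: le_less_trans)
  have "L2_sq \<Omega> v \<le> ennreal (4 * C) * gagliardo_energy s v + ennreal e" if e: "0 < e" for e :: real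
  proof -
    \<comment> \<open>Mass and energy of the difference are at most \<open>r\<^sup>2\<close> each; they enter the final estimate with total weight \<open>4 C + 2\<close>.\<close>
    define r where "r = sqrt (e / (4 * C + 2))"
    have r: "0 < r" "(4 * C + 2) * r\<^sup>2 = e" using e C by (auto simp: r_def)
    obtain m where m: "Hs_norm \<Omega> s (\<lambda>x. \<phi> m x - u x) < r"
      using order_tendstoD(2)[OF lim r(1)] by (auto simp: eventually_sequentially)
    note f = test_function_borel_measurable[OF \<phi>[of m]]
    define d where "d x = \<phi> m x - v x" for x
    have d: "d \<in> borel_measurable borel" using f v unfolding d_def by measurable
    have norm_d: "sqrt (enn2real (L2_sq \<Omega> d)) + sqrt (enn2real (gagliardo_energy s d)) < r"
      using m unfolding Hs_norm_def L2_sq_cong_AE[OF diff_v] gagliardo_energy_cong_AE[OF diff_v]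
      by (simp add: d_def[abs_def])
    have "L2_sq \<Omega> (\<phi> m) \<le> (\<integral>\<^sup>+x. ennreal ((\<phi> m x)\<^sup>2) \<partial>lborel)"
      unfolding L2_sq_lborel by (intro nn_integral_mono) (auto simp: indicator_def)
    also have "\<dots> < \<infinity>" by (rule test_function_L2_finite[OF \<phi>])
    finally have L2_phi_fin: "L2_sq \<Omega> (\<phi> m) < \<infinity>" .
    have "L2_sq \<Omega> d \<le> 2 * L2_sq \<Omega> (\<phi> m) + 2 * L2_sq \<Omega> v"
      by (rule L2_sq_le_add[OF f v \<Omega>]) (simp add: d_def)
    also have "\<dots> < \<infinity>"
      using L2_phi_fin L2_v_fin by (simp add: ennreal_mult_less_top)
    finally have L2_d_fin: "L2_sq \<Omega> d < \<infinity>" .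
    have "gagliardo_energy s d \<le> 2 * gagliardo_energy s (\<phi> m) + 2 * gagliardo_energy s v"
      by (rule gagliardo_energy_le_add[OF f v]) (simp add: d_def)
    also have "\<dots> < \<infinity>"
      using fin(2) test_function_energy_finite[OF \<phi> s] by (simp add: ennreal_mult_less_top E_v)
    finally have E_d_fin: "gagliardo_energy s d < \<infinity>" .
    have small: "X \<le> ennreal (r\<^sup>2)" if "X < \<infinity>" "sqrt (enn2real X) < r" for X
    proof -
      have "enn2real X \<le> r\<^sup>2" by (rule sqrt_le_D[OF less_imp_le[OF that(2)]])
      then have "ennreal (enn2real X) \<le> ennreal (r\<^sup>2)" by (rule ennreal_leI)
      moreover have "ennreal (enn2real X) = X" using that(1) by simp
      ultimately show ?thesis by (simp only:)
    qed
    have nonneg: "0 \<le> sqrt (enn2real X)" for X by simp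
    have "sqrt (enn2real (L2_sq \<Omega> d)) < r" "sqrt (enn2real (gagliardo_energy s d)) < r"
      using norm_d nonneg[of "L2_sq \<Omega> d"] nonneg[of "gagliardo_energy s d"] by linarith+
    then have L2_d: "L2_sq \<Omega> d \<le> ennreal (r\<^sup>2)" and E_d: "gagliardo_energy s d \<le> ennreal (r\<^sup>2)"
      using small[OF L2_d_fin] small[OF E_d_fin] by blast+
    have "L2_sq \<Omega> v \<le> 2 * L2_sq \<Omega> (\<phi> m) + 2 * L2_sq \<Omega> d"
      by (rule L2_sq_le_add[OF f d \<Omega>]) (simp add: d_def)
    also have "\<dots> \<le> 2 * (ennreal C * gagliardo_energy s (\<phi> m)) + 2 * ennreal (r\<^sup>2)"
      by (intro add_mono mult_left_mono test \<phi> L2_d) auto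
    also have "\<dots> \<le> 2 * (ennreal C * (2 * gagliardo_energy s v + 2 * ennreal (r\<^sup>2))) + 2 * ennreal (r\<^sup>2)"
    proof (intro add_mono mult_left_mono order_refl)
      have "gagliardo_energy s (\<phi> m) \<le> 2 * gagliardo_energy s v + 2 * gagliardo_energy s d"
        by (rule gagliardo_energy_le_add[OF v d]) (simp add: d_def)
      also have "\<dots> \<le> 2 * gagliardo_energy s v + 2 * ennreal (r\<^sup>2)"
        by (intro add_mono mult_left_mono E_d) auto
      finally show "gagliardo_energy s (\<phi> m) \<le> 2 * gagliardo_energy s v + 2 * ennreal (r\<^sup>2)" .
    qed auto
    also have "\<dots> = ennreal (4 * C) * gagliardo_energy s v + ennreal ((4 * C + 2) * r\<^sup>2)"
    proof -
      obtain a where a: "gagliardo_energy s v = ennreal a" "0 \<le> a"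
        using fin(2) unfolding E_v by (cases "gagliardo_energy s v") auto
      have "2 * (ennreal C * (2 * ennreal a + 2 * ennreal (r\<^sup>2))) + 2 * ennreal (r\<^sup>2)
          = ennreal (2 * (C * (2 * a + 2 * r\<^sup>2)) + 2 * r\<^sup>2)"
        using a(2) C by (simp add: ennreal_mult)
      also have "2 * (C * (2 * a + 2 * r\<^sup>2)) + 2 * r\<^sup>2 = 4 * C * a + (4 * C + 2) * r\<^sup>2"
        by (simp add: algebra_simps)
      also have "ennreal (4 * C * a + (4 * C + 2) * r\<^sup>2) = ennreal (4 * C) * ennreal a + ennreal ((4 * C + 2) * r\<^sup>2)"
        using a(2) C by (subst ennreal_plus) (simp_all add: ennreal_mult)
      finally show ?thesis unfolding a(1) .
    qed
    finally show ?thesis unfolding r(2) .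
  qed
  then show ?thesis unfolding L2_v E_v
    by (rule ennreal_le_epsilon) auto
qed

section \<open>Positivity of the Poincare constant\<close>

theorem mainTheorem5:
  fixes \<sigma> :: "nat \<Rightarrow> real" and t s :: real
  assumes "0 < t" and "t < 1/2"
    and "\<And>j. j \<ge> 1 \<Longrightarrow> \<sigma> j > 0"
    and "antimono_on {1..} \<sigma>"
    and "summable (\<lambda>j. \<sigma> (Suc j) powr (1 - 2 * t))"
    and "\<sigma> 0 = 0"
    and "1/2 < s" and "s < 1"
  shows "fractional_poincare s (strip_domain \<sigma>) > 0"
proof -
  let ?\<Omega> = "strip_domain \<sigma>"
  have s: "1/2 < s" "s < 1" "0 < s" using assms by auto
  have \<sigma>: "0 \<le> \<sigma> j" for j using assms(3)[of j] assms(6) by (cases "j = 0") auto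
  have "open ?\<Omega>" unfolding strip_domain_def by (intro open_Un open_UN ballI open_Times) auto
  then have \<Omega>: "?\<Omega> \<in> sets borel" by simp
  define C where "C = hardy_const s 3 * 5 powr (1 + s)"
  have C: "0 < C"
    using s two_powr_neg_lt_half[OF s(1)] by (simp add: C_def hardy_const_def)
  have test: "L2_sq ?\<Omega> \<phi> \<le> ennreal C * gagliardo_energy s \<phi>" if \<phi>: "\<phi> \<in> test_functions ?\<Omega>" for \<phi>
  proof -
    obtain B where B: "0 \<le> B" "\<And>x y. \<bar>\<phi> x - \<phi> y\<bar> \<le> B * norm (x - y)"
      using test_function_Lipschitz[OF \<phi>] by blast
    have "L2_sq ?\<Omega> \<phi> \<le> (\<integral>\<^sup>+x. ennreal ((\<phi> x)\<^sup>2) \<partial>lborel)"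
      unfolding L2_sq_lborel by (intro nn_integral_mono) (auto simp: indicator_def)
    also have "\<dots> \<le> ennreal (hardy_const s 3) * (ennreal (5 powr (1 + s)) * gagliardo_energy s \<phi>)"
    proof (rule fractional_poincare_by_slicing[OF test_function_borel_measurable[OF \<phi>] s(1,2) _ B(2,1)])
      show "\<exists>x\<in>{a..a + 3}. \<phi> (x, c + m * x) = 0" if "1 \<le> m" for c m a
        using slanted_line_leaves_strip_domain[of \<sigma> m a c] \<sigma> that test_functionD(4)[OF \<phi>] by blast
    qed auto
    also have "\<dots> = ennreal C * gagliardo_energy s \<phi>"
      by (simp add: C_def ennreal_mult'' mult.assoc)
    finally show ?thesis .
  qed
  have "ennreal (1 / (4 * C)) \<le> gagliardo_energy s u / L2_sq ?\<Omega> u"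
    if u: "u \<in> Hs_closure ?\<Omega> s" and nz: "\<not> (AE x in lebesgue. u x = 0)" for u
  proof -
    from u have "u \<in> borel_measurable lebesgue" and fin: "L2_sq UNIV u < \<infinity>" "gagliardo_energy s u < \<infinity>"
      by (auto simp: Hs_closure_def Hs_space_def)
    then obtain v where v: "v \<in> borel_measurable borel" and uv: "AE x in lborel. u x = v x"
      using completion_ex_borel_measurable_real[of u lborel] by auto
    have E_nz: "gagliardo_energy s u \<noteq> 0"
    proof
      assume "gagliardo_energy s u = 0"
      then have "AE x in lborel. v x = 0"
        using fin(1) zero_energy_imp_AE_zero[OF v, of s]
        unfolding L2_sq_cong_AE[OF uv] gagliardo_energy_cong_AE[OF uv] by blast
      with uv have "AE x in lborel. u x = 0" by eventually_elim simp
      with nz show False by (simp add: AE_completion_iff)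
    qed
    obtain a where a: "gagliardo_energy s u = ennreal a" "0 \<le> a"
      using fin(2) by (cases "gagliardo_energy s u") auto
    have le: "L2_sq ?\<Omega> u \<le> ennreal (4 * C * a)"
      using Hs_closure_poincare[OF u s(3,2) less_imp_le[OF C] \<Omega> test] a C
      by (simp add: ennreal_mult')
    then obtain b where b: "L2_sq ?\<Omega> u = ennreal b" "0 \<le> b"
      by (cases "L2_sq ?\<Omega> u") (auto simp: top_unique)
    show ?thesis
    proof (cases "b = 0")
      case True
      then show ?thesis using E_nz b by simp
    next
      case False
      then have "1 / (4 * C) \<le> a / b" using le a b C by (simp add: field_simps)
      then show ?thesis using False a b by (simp add: divide_ennreal ennreal_leI)
    qed
  qed
  then have "ennreal (1 / (4 * C)) \<le> fractional_poincare s ?\<Omega>"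
    unfolding fractional_poincare_def by (intro INF_greatest) auto
  moreover have "0 < ennreal (1 / (4 * C))" using C by simp
  ultimately show ?thesis by (rule less_le_trans[rotated])
qed

end
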